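(* Let $R$ be a prime $n$-CH algebra (over a field of characteristic $0$) with trace algebra $A$, and let $G$ be the field of fractions of $A$. Then $R\otimes_AG$ is a simple $n$-CH algebra with trace algebra $G$, and $R\subset R\otimes_AG$ (i.e. the natural map $R\to R\otimes_AG$ is injective).
   Context: An algebra with trace is an associative unital algebra $R$ over a field with a linear map $t:R\to R$ such that $t(a)b=b\,t(a)$, $t(ab)=t(ba)$, $t(t(a)b)=t(a)t(b)$ for all $a,b\in R$. The commutative central subalgebra $t(R)$ is the trace algebra of $R$. A trace ideal is a two-sided ideal $I$ with $t(I)\subset I$. A trace algebra is simple if it is nonzero and has no trace ideals other than $0$ and itself; it is prime if it is nonzero and, for trace ideals $I,J$, $IJ=0$ implies $I=0$ or $J=0$. (If $R$ is a prime $n$-CH algebra its trace algebra is a domain.) If $U$ is a commutative $A$-algebra, with $A=t(R)$, then $U\otimes_AR$ has the trace $t(u\otimes r)=u\otimes t(r)$. In characteristic $0$ define $\sigma_i(x)$ by $\sum_{i\ge 0}(-1)^i\sigma_i(x)u^i=\exp\bigl(-\sum_{j\ge1}\frac{t(x^j)}{j}u^j\bigr)$ and $CH_n(x):=x^n+\sum_{i=1}^n(-1)^i\sigma_i(x)x^{n-i}$. An $n$-Cayley–Hamilton algebra ($n$-CH algebra) is an algebra with trace with $t(1)=n$ and $CH_n(a)=0$ for all $a$ (equivalently, satisfying the full polarization of $CH_n$). *)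

theory Defs
  imports "HOL-Algebra.QuotRing" "HOL-Algebra.Ideal_Product" "HOL-Algebra.Module"
    "HOL-Algebra.Free_Abelian_Groups"
begin

section \<open>Algebras with trace\<close>

text \<open>The library locale \<open>algebra\<close> assumes a commutative ring of vectors, so associative unital
  algebras over a field are introduced here.\<close>

locale assoc_algebra = K?: field K + module K R + R?: ring R
  for K (structure) and R (structure) +
  assumes smult_mult_left:
    "\<lbrakk>c \<in> carrier K; x \<in> carrier R; y \<in> carrier R\<rbrakk>
      \<Longrightarrow> (c \<odot>\<^bsub>R\<^esub> x) \<otimes>\<^bsub>R\<^esub> y = c \<odot>\<^bsub>R\<^esub> (x \<otimes>\<^bsub>R\<^esub> y)"
    and smult_mult_right:
    "\<lbrakk>c \<in> carrier K; x \<in> carrier R; y \<in> carrier R\<rbrakk>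
      \<Longrightarrow> x \<otimes>\<^bsub>R\<^esub> (c \<odot>\<^bsub>R\<^esub> y) = c \<odot>\<^bsub>R\<^esub> (x \<otimes>\<^bsub>R\<^esub> y)"

locale trace_algebra = assoc_algebra K R
  for K (structure) and R (structure) +
  fixes t :: "_ \<Rightarrow> _"
  assumes trace_closed: "x \<in> carrier R \<Longrightarrow> t x \<in> carrier R"
    and trace_add:
    "\<lbrakk>x \<in> carrier R; y \<in> carrier R\<rbrakk> \<Longrightarrow> t (x \<oplus>\<^bsub>R\<^esub> y) = t x \<oplus>\<^bsub>R\<^esub> t y"
    and trace_smult:
    "\<lbrakk>c \<in> carrier K; x \<in> carrier R\<rbrakk> \<Longrightarrow> t (c \<odot>\<^bsub>R\<^esub> x) = c \<odot>\<^bsub>R\<^esub> t x"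
    and trace_central:
    "\<lbrakk>a \<in> carrier R; b \<in> carrier R\<rbrakk> \<Longrightarrow> t a \<otimes>\<^bsub>R\<^esub> b = b \<otimes>\<^bsub>R\<^esub> t a"
    and trace_commute:
    "\<lbrakk>a \<in> carrier R; b \<in> carrier R\<rbrakk> \<Longrightarrow> t (a \<otimes>\<^bsub>R\<^esub> b) = t (b \<otimes>\<^bsub>R\<^esub> a)"
    and trace_trace_mult:
    "\<lbrakk>a \<in> carrier R; b \<in> carrier R\<rbrakk> \<Longrightarrow> t (t a \<otimes>\<^bsub>R\<^esub> b) = t a \<otimes>\<^bsub>R\<^esub> t b"

text \<open>The trace algebra \<open>t(R)\<close> keeps the unit of \<open>R\<close>; this unit lies in \<open>t(R)\<close> as soon as \<open>t(1)\<close>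
  is a nonzero integer in characteristic zero.\<close>

definition trace_ring :: "('a, 'm) ring_scheme \<Rightarrow> ('a \<Rightarrow> 'a) \<Rightarrow> ('a, 'm) ring_scheme"
  where "trace_ring R t = R\<lparr>carrier := t ` carrier R\<rparr>"

definition trace_ideal :: "'a set \<Rightarrow> ('a, 'm) ring_scheme \<Rightarrow> ('a \<Rightarrow> 'a) \<Rightarrow> bool"
  where "trace_ideal I R t \<longleftrightarrow> ideal I R \<and> t ` I \<subseteq> I"

definition trace_simple :: "('a, 'm) ring_scheme \<Rightarrow> ('a \<Rightarrow> 'a) \<Rightarrow> bool"
  where "trace_simple R t \<longleftrightarrow>
    carrier R \<noteq> {\<zero>\<^bsub>R\<^esub>} \<and>
    (\<forall>I. trace_ideal I R t \<longrightarrow> I = {\<zero>\<^bsub>R\<^esub>} \<or> I = carrier R)"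

definition trace_prime :: "('a, 'm) ring_scheme \<Rightarrow> ('a \<Rightarrow> 'a) \<Rightarrow> bool"
  where "trace_prime R t \<longleftrightarrow>
    carrier R \<noteq> {\<zero>\<^bsub>R\<^esub>} \<and>
    (\<forall>I J. trace_ideal I R t \<longrightarrow> trace_ideal J R t \<longrightarrow> ideal_prod R I J = {\<zero>\<^bsub>R\<^esub>}
      \<longrightarrow> I = {\<zero>\<^bsub>R\<^esub>} \<or> J = {\<zero>\<^bsub>R\<^esub>})"


section \<open>Cayley--Hamilton algebras\<close>

text \<open>Formal power series over \<open>R\<close> are coefficient sequences \<open>nat \<Rightarrow> 'a\<close>.\<close>

definition ps_mult :: "('a, 'm) ring_scheme \<Rightarrow> (nat \<Rightarrow> 'a) \<Rightarrow> (nat \<Rightarrow> 'a) \<Rightarrow> nat \<Rightarrow> 'a"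
  where "ps_mult R f g i = (\<Oplus>\<^bsub>R\<^esub>k\<in>{..i}. f k \<otimes>\<^bsub>R\<^esub> g (i - k))"

primrec ps_pow :: "('a, 'm) ring_scheme \<Rightarrow> (nat \<Rightarrow> 'a) \<Rightarrow> nat \<Rightarrow> nat \<Rightarrow> 'a"
  where
    "ps_pow R f 0 = (\<lambda>i. if i = 0 then \<one>\<^bsub>R\<^esub> else \<zero>\<^bsub>R\<^esub>)"
  | "ps_pow R f (Suc m) = ps_mult R (ps_pow R f m) f"

definition of_nat_field :: "('k, 'l) ring_scheme \<Rightarrow> nat \<Rightarrow> 'k"
  where "of_nat_field K m = [m] \<cdot>\<^bsub>K\<^esub> \<one>\<^bsub>K\<^esub>"

text \<open>The series \<open>exp f = (\<Sum>m. f^m / m!)\<close> for \<open>f\<close> with zero constant term: \<open>f^m\<close> then has no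
  terms of degree below \<open>m\<close>, so only \<open>m \<le> i\<close> contributes to the coefficient of degree \<open>i\<close>.\<close>

definition ps_exp ::
    "('k, 'l) ring_scheme \<Rightarrow> ('k, 'a, 'm) module_scheme \<Rightarrow> (nat \<Rightarrow> 'a) \<Rightarrow> nat \<Rightarrow> 'a"
  where "ps_exp K R f i =
    (\<Oplus>\<^bsub>R\<^esub>m\<in>{..i}. inv\<^bsub>K\<^esub> (of_nat_field K (fact m)) \<odot>\<^bsub>R\<^esub> ps_pow R f m i)"

definition trace_log_series ::
    "('k, 'l) ring_scheme \<Rightarrow> ('k, 'a, 'm) module_scheme \<Rightarrow> ('a \<Rightarrow> 'a) \<Rightarrow> 'a \<Rightarrow> nat \<Rightarrow> 'a"
  where "trace_log_series K R t x j =
    (if j = 0 then \<zero>\<^bsub>R\<^esub>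
     else \<ominus>\<^bsub>R\<^esub> (inv\<^bsub>K\<^esub> (of_nat_field K j) \<odot>\<^bsub>R\<^esub> t (x [^]\<^bsub>R\<^esub> j)))"

definition sigma ::
    "('k, 'l) ring_scheme \<Rightarrow> ('k, 'a, 'm) module_scheme \<Rightarrow> ('a \<Rightarrow> 'a) \<Rightarrow> nat \<Rightarrow> 'a \<Rightarrow> 'a"
  where "sigma K R t i x =
    (\<ominus>\<^bsub>R\<^esub> \<one>\<^bsub>R\<^esub>) [^]\<^bsub>R\<^esub> i \<otimes>\<^bsub>R\<^esub> ps_exp K R (trace_log_series K R t x) i"

definition CH_poly ::
    "nat \<Rightarrow> ('k, 'l) ring_scheme \<Rightarrow> ('k, 'a, 'm) module_scheme \<Rightarrow> ('a \<Rightarrow> 'a) \<Rightarrow> 'a \<Rightarrow> 'a"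
  where "CH_poly n K R t x =
    x [^]\<^bsub>R\<^esub> n \<oplus>\<^bsub>R\<^esub>
    (\<Oplus>\<^bsub>R\<^esub>i\<in>{1..n}. (\<ominus>\<^bsub>R\<^esub> \<one>\<^bsub>R\<^esub>) [^]\<^bsub>R\<^esub> i \<otimes>\<^bsub>R\<^esub> sigma K R t i x \<otimes>\<^bsub>R\<^esub> x [^]\<^bsub>R\<^esub> (n - i))"

locale char_zero_field = field K for K (structure) +
  assumes char_zero: "0 < m \<Longrightarrow> of_nat_field K m \<noteq> \<zero>"

locale CH_algebra = trace_algebra K R t + char_zero_field K
  for n :: nat and K (structure) and R (structure) and t +
  assumes trace_one: "t \<one>\<^bsub>R\<^esub> = [n] \<cdot>\<^bsub>R\<^esub> \<one>\<^bsub>R\<^esub>"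
    and Cayley_Hamilton: "x \<in> carrier R \<Longrightarrow> CH_poly n K R t x = \<zero>\<^bsub>R\<^esub>"


section \<open>Field of fractions\<close>

text \<open>The equivalence class of the pair \<open>(a, b)\<close>.\<close>

definition fraction :: "('a, 'm) ring_scheme \<Rightarrow> 'a \<Rightarrow> 'a \<Rightarrow> ('a \<times> 'a) set"
  where "fraction A a b =
    {(c, d). c \<in> carrier A \<and> d \<in> carrier A - {\<zero>\<^bsub>A\<^esub>} \<and> a \<otimes>\<^bsub>A\<^esub> d = c \<otimes>\<^bsub>A\<^esub> b}"

text \<open>As for \<^const>\<open>rcoset_mult\<close>, an operation on classes is the union over all representatives;
  for a domain \<open>A\<close> all members of such a union coincide.\<close>

definition fraction_field :: "('a, 'm) ring_scheme \<Rightarrow> ('a \<times> 'a) set ring"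
  where "fraction_field A =
    \<lparr>carrier = {fraction A a b | a b. a \<in> carrier A \<and> b \<in> carrier A - {\<zero>\<^bsub>A\<^esub>}},
     monoid.mult = (\<lambda>X Y. \<Union>(a, b)\<in>X. \<Union>(c, d)\<in>Y. fraction A (a \<otimes>\<^bsub>A\<^esub> c) (b \<otimes>\<^bsub>A\<^esub> d)),
     one = fraction A \<one>\<^bsub>A\<^esub> \<one>\<^bsub>A\<^esub>,
     ring.zero = fraction A \<zero>\<^bsub>A\<^esub> \<one>\<^bsub>A\<^esub>,
     ring.add = (\<lambda>X Y. \<Union>(a, b)\<in>X. \<Union>(c, d)\<in>Y.
       fraction A (a \<otimes>\<^bsub>A\<^esub> d \<oplus>\<^bsub>A\<^esub> c \<otimes>\<^bsub>A\<^esub> b) (b \<otimes>\<^bsub>A\<^esub> d))\<rparr>"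

definition fraction_embedding :: "('a, 'm) ring_scheme \<Rightarrow> 'a \<Rightarrow> ('a \<times> 'a) set"
  where "fraction_embedding A a = fraction A a \<one>\<^bsub>A\<^esub>"


section \<open>Extension of scalars\<close>

text \<open>For a central subring \<open>A\<close> of \<open>R\<close> and a commutative \<open>A\<close>-algebra \<open>U\<close> with structure map \<open>\<beta>\<close>,
  the tensor product \<open>R \<otimes>\<^sub>A U\<close> is the free abelian group on \<open>R \<times> U\<close>, with the biadditive
  multiplication \<open>(r, u)(s, v) = (r s, u v)\<close>, modulo the subgroup generated by the usual
  bilinearity and balancing relations.\<close>

definition pair_ring ::
    "('a, 'm) ring_scheme \<Rightarrow> ('g, 'h) ring_scheme \<Rightarrow> (('a \<times> 'g) \<Rightarrow>\<^sub>0 int) ring"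
  where "pair_ring R U =
    \<lparr>carrier = carrier (free_Abelian_group (carrier R \<times> carrier U)),
     monoid.mult = (\<lambda>p q. frag_extend (\<lambda>(r, u). frag_extend (\<lambda>(s, v).
       frag_of (r \<otimes>\<^bsub>R\<^esub> s, u \<otimes>\<^bsub>U\<^esub> v)) q) p),
     one = frag_of (\<one>\<^bsub>R\<^esub>, \<one>\<^bsub>U\<^esub>),
     ring.zero = 0,
     ring.add = (+)\<rparr>"

definition tensor_relations ::
    "('a, 'l) ring_scheme \<Rightarrow> ('a, 'm) ring_scheme \<Rightarrow> ('g, 'h) ring_scheme \<Rightarrow> ('a \<Rightarrow> 'g)
      \<Rightarrow> (('a \<times> 'g) \<Rightarrow>\<^sub>0 int) set"
  where "tensor_relations A R U \<beta> = generate (add_monoid (pair_ring R U))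
    ({frag_of (r \<oplus>\<^bsub>R\<^esub> s, u) - frag_of (r, u) - frag_of (s, u) | r s u.
        r \<in> carrier R \<and> s \<in> carrier R \<and> u \<in> carrier U} \<union>
     {frag_of (r, u \<oplus>\<^bsub>U\<^esub> v) - frag_of (r, u) - frag_of (r, v) | r u v.
        r \<in> carrier R \<and> u \<in> carrier U \<and> v \<in> carrier U} \<union>
     {frag_of (r \<otimes>\<^bsub>R\<^esub> a, u) - frag_of (r, \<beta> a \<otimes>\<^bsub>U\<^esub> u) | r a u.
        r \<in> carrier R \<and> a \<in> carrier A \<and> u \<in> carrier U})"

text \<open>The map on classes induced by a map \<open>\<phi>\<close> of generators, again as a union over all
  representatives.\<close>

definition tensor_lift ::
    "('a, 'l) ring_scheme \<Rightarrow> ('a, 'm) ring_scheme \<Rightarrow> ('g, 'h) ring_scheme \<Rightarrow> ('a \<Rightarrow> 'g)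
      \<Rightarrow> ('a \<times> 'g \<Rightarrow> 'a \<times> 'g) \<Rightarrow> (('a \<times> 'g) \<Rightarrow>\<^sub>0 int) set \<Rightarrow> (('a \<times> 'g) \<Rightarrow>\<^sub>0 int) set"
  where "tensor_lift A R U \<beta> \<phi> X =
    (\<Union>p\<in>X. tensor_relations A R U \<beta> +>\<^bsub>pair_ring R U\<^esub> frag_extend (frag_of \<circ> \<phi>) p)"

text \<open>The scalars of the ground field of \<open>R\<close> act by \<open>c (r \<otimes> u) = (c r) \<otimes> u\<close>.\<close>

definition tensor_algebra ::
    "('a, 'l) ring_scheme \<Rightarrow> ('k, 'a, 'm) module_scheme \<Rightarrow> ('g, 'h) ring_scheme \<Rightarrow> ('a \<Rightarrow> 'g)
      \<Rightarrow> ('k, (('a \<times> 'g) \<Rightarrow>\<^sub>0 int) set) module"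
  where "tensor_algebra A R U \<beta> =
    (let Q = pair_ring R U Quot tensor_relations A R U \<beta> in
    \<lparr>carrier = carrier Q, monoid.mult = monoid.mult Q, one = one Q,
     ring.zero = ring.zero Q, ring.add = ring.add Q,
     smult = (\<lambda>c. tensor_lift A R U \<beta> (\<lambda>(r, u). (c \<odot>\<^bsub>R\<^esub> r, u)))\<rparr>)"

definition pure_tensor ::
    "('a, 'l) ring_scheme \<Rightarrow> ('a, 'm) ring_scheme \<Rightarrow> ('g, 'h) ring_scheme \<Rightarrow> ('a \<Rightarrow> 'g)
      \<Rightarrow> 'a \<Rightarrow> 'g \<Rightarrow> (('a \<times> 'g) \<Rightarrow>\<^sub>0 int) set"
  where "pure_tensor A R U \<beta> r u = tensor_relations A R U \<beta> +>\<^bsub>pair_ring R U\<^esub> frag_of (r, u)"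

text \<open>The trace \<open>r \<otimes> u \<mapsto> t(r) \<otimes> u\<close>.\<close>

definition tensor_trace ::
    "('a, 'l) ring_scheme \<Rightarrow> ('a, 'm) ring_scheme \<Rightarrow> ('g, 'h) ring_scheme \<Rightarrow> ('a \<Rightarrow> 'g) \<Rightarrow> ('a \<Rightarrow> 'a)
      \<Rightarrow> (('a \<times> 'g) \<Rightarrow>\<^sub>0 int) set \<Rightarrow> (('a \<times> 'g) \<Rightarrow>\<^sub>0 int) set"
  where "tensor_trace A R U \<beta> t = tensor_lift A R U \<beta> (\<lambda>(r, u). (t r, u))"

end

theory Submission
  imports Defs "HOL-Algebra.Subrings"
begin

text \<open>Write \<open>A = t(R)\<close>. If \<open>a \<in> A\<close> is nonzero, then \<open>a R\<close> and the annihilator of \<open>a\<close> are trace ideals with product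
  zero, so \<open>R\<close> is torsion free over the domain \<open>A\<close>; hence \<open>R\<close> embeds into the localization
  \<open>R \<otimes>\<^sub>A G\<close>, whose elements all have the form \<open>r \<otimes> 1/d\<close>. The Cayley--Hamilton polynomial is
  homogeneous of degree \<open>n\<close>, so it vanishes at \<open>r \<otimes> 1/d\<close>.

  A nonzero trace ideal of \<open>R \<otimes>\<^sub>A G\<close> contracts to a nonzero trace ideal \<open>J\<close> of \<open>R\<close>. If \<open>t\<close> does not vanish
  on \<open>J\<close>, the ideal contains a nonzero element of \<open>G\<close> and is everything. If \<open>t\<close> vanishes on \<open>J\<close>, the
  Cayley--Hamilton identity reduces to \<open>x^n = 0\<close> on \<open>J\<close>; in characteristic zero a nonzero nil ideal
  of bounded index contains \<open>b \<noteq> 0\<close> with \<open>b J b = 0\<close>, which contradicts primeness.\<close>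

section \<open>The field of fractions of a domain\<close>

text \<open>\<open>R \<otimes> G\<close> is a quotient of a free abelian group, so showing that
  \<open>r \<otimes> 1\<close> is nonzero takes a map out of it. The maps used send
  \<open>r \<otimes> u\<close> to \<open>r (d u)\<close>, one map into \<open>R\<close> for each
  denominator \<open>d\<close>; a relation need not die under a given one, only under those
  belonging to all multiples of some \<open>d\<close>. The Cayley--Hamilton identity is not
  additive, so checking it on additive generators would not do. Over \<open>G\<close> every tensor
  is a single pure tensor, and \<open>sigma\<close> of index \<open>i\<close> has weight
  \<open>i\<close>, so \<open>r \<otimes> u\<close> gives the value at \<open>r\<close> tensored
  with \<open>u^n\<close>. If \<open>t\<close> kills an ideal \<open>J\<close>, then
  \<open>t(x^j) = 0\<close> for all \<open>j \<ge> 1\<close> and \<open>x\<close> in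
  \<open>J\<close>; the logarithmic series is zero, its exponential is 1, and only
  \<open>x^n\<close> survives. Linearizing \<open>x^k = 0\<close> uses integer multiples alone:
  \<open>(a + m y)^k = 0\<close> for all \<open>m\<close>, with \<open>k\<close> minimal. The
  element \<open>b\<close> is a nonzero power \<open>a^(k-1)\<close>. Primeness speaks of trace
  ideals only, and annihilators in \<open>R\<close> of an element like \<open>b\<close> need not be
  stable under \<open>t\<close>. Inside \<open>J\<close> every ideal is stable, because
  \<open>t\<close> is zero there.\<close>

context domain
begin

text \<open>The point is transitivity of cross-multiplication: in \<open>sub\<close> the two
  relations are combined and the nonzero \<open>b\<close> is cancelled, which is where the domain
  property enters.\<close>

lemma fraction_eq_iff:
  assumes "a \<in> carrier R" "b \<in> carrier R - {\<zero>}" "c \<in> carrier R" "d \<in> carrier R - {\<zero>}"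
  shows "fraction R a b = fraction R c d \<longleftrightarrow> a \<otimes> d = c \<otimes> b"
proof
  assume "fraction R a b = fraction R c d"
  moreover have "(a, b) \<in> fraction R a b" using assms by (auto simp: fraction_def)
  ultimately have "(a, b) \<in> fraction R c d" by simp
  then show "a \<otimes> d = c \<otimes> b" by (simp add: fraction_def)
next
  have sub: "fraction R a b \<subseteq> fraction R c d"
    if "a \<in> carrier R" "b \<in> carrier R - {\<zero>}" "c \<in> carrier R" "d \<in> carrier R - {\<zero>}"
      "a \<otimes> d = c \<otimes> b" for a b c d
  proof
    fix x assume "x \<in> fraction R a b"
    then obtain e f where x: "x = (e, f)" and ef: "e \<in> carrier R" "f \<in> carrier R - {\<zero>}"
      and eq: "a \<otimes> f = e \<otimes> b" by (auto simp: fraction_def)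
    have "b \<otimes> (c \<otimes> f) = (c \<otimes> b) \<otimes> f" using that ef by (simp add: m_ac)
    also have "\<dots> = (a \<otimes> f) \<otimes> d" using that ef by (simp flip: that(5) add: m_ac)
    also have "\<dots> = b \<otimes> (e \<otimes> d)" unfolding eq using that ef by (simp add: m_ac)
    finally have "c \<otimes> f = e \<otimes> d" using that ef m_lcancel by auto
    then show "x \<in> fraction R c d" using x ef by (simp add: fraction_def)
  qed
  assume "a \<otimes> d = c \<otimes> b"
  then show "fraction R a b = fraction R c d"
    using sub[OF assms] sub[OF assms(3,4,1,2)] by auto
qed

text \<open>A union over all representatives collapses to the value at one chosen pair, because the
  family is constant and neither class is empty. This evaluates both operations of
  \<open>fraction_field\<close>.\<close>

lemma fraction_union:
  assumes "a \<in> carrier R" "b \<in> carrier R - {\<zero>}" "c \<in> carrier R" "d \<in> carrier R - {\<zero>}"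
    and const: "\<And>a' b' c' d'. \<lbrakk>(a', b') \<in> fraction R a b; (c', d') \<in> fraction R c d\<rbrakk>
      \<Longrightarrow> F a' b' c' d' = F a b c d"
  shows "(\<Union>(a', b')\<in>fraction R a b. \<Union>(c', d')\<in>fraction R c d. F a' b' c' d') = F a b c d"
proof -
  have self: "(a, b) \<in> fraction R a b" "(c, d) \<in> fraction R c d"
    using assms by (auto simp: fraction_def)
  show ?thesis
  proof
    show "F a b c d \<subseteq> (\<Union>(a', b')\<in>fraction R a b. \<Union>(c', d')\<in>fraction R c d. F a' b' c' d')"
      using self by blast
    show "(\<Union>(a', b')\<in>fraction R a b. \<Union>(c', d')\<in>fraction R c d. F a' b' c' d') \<subseteq> F a b c d"
    proof
      fix x assume "x \<in> (\<Union>(a', b')\<in>fraction R a b. \<Union>(c', d')\<in>fraction R c d. F a' b' c' d')"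
      then obtain a' b' c' d' where h: "(a', b') \<in> fraction R a b" "(c', d') \<in> fraction R c d"
        "x \<in> F a' b' c' d'" by blast
      then show "x \<in> F a b c d" using const[OF h(1,2)] by simp
    qed
  qed
qed

lemma mult_nonzero:
  "\<lbrakk>b \<in> carrier R - {\<zero>}; d \<in> carrier R - {\<zero>}\<rbrakk> \<Longrightarrow> b \<otimes> d \<in> carrier R - {\<zero>}"
  using integral_iff by auto

lemma fraction_mult:
  assumes "a \<in> carrier R" "b \<in> carrier R - {\<zero>}" "c \<in> carrier R" "d \<in> carrier R - {\<zero>}"
  shows "fraction R a b \<otimes>\<^bsub>fraction_field R\<^esub> fraction R c d = fraction R (a \<otimes> c) (b \<otimes> d)"
proof -
  have "fraction R (a' \<otimes> c') (b' \<otimes> d') = fraction R (a \<otimes> c) (b \<otimes> d)"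
    if "(a', b') \<in> fraction R a b" "(c', d') \<in> fraction R c d" for a' b' c' d'
  proof -
    have h: "a' \<in> carrier R" "b' \<in> carrier R - {\<zero>}" "c' \<in> carrier R" "d' \<in> carrier R - {\<zero>}"
      "a \<otimes> b' = a' \<otimes> b" "c \<otimes> d' = c' \<otimes> d"
      using that by (auto simp: fraction_def)
    have "(a' \<otimes> c') \<otimes> (b \<otimes> d) = (a' \<otimes> b) \<otimes> (c' \<otimes> d)" using assms h by (simp add: m_ac)
    also have "\<dots> = (a \<otimes> c) \<otimes> (b' \<otimes> d')"
      unfolding h(5,6)[symmetric] using assms h(1-4) by (simp add: m_ac)
    finally show ?thesis
      using assms h mult_nonzero by (subst fraction_eq_iff) auto
  qed
  then show ?thesis
    by (simp add: fraction_field_def fraction_union[OF assms, where F = "\<lambda>a b c d. fraction R (a \<otimes> c) (b \<otimes> d)"])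
qed

lemma fraction_add:
  assumes "a \<in> carrier R" "b \<in> carrier R - {\<zero>}" "c \<in> carrier R" "d \<in> carrier R - {\<zero>}"
  shows "fraction R a b \<oplus>\<^bsub>fraction_field R\<^esub> fraction R c d
    = fraction R (a \<otimes> d \<oplus> c \<otimes> b) (b \<otimes> d)"
proof -
  have "fraction R (a' \<otimes> d' \<oplus> c' \<otimes> b') (b' \<otimes> d') = fraction R (a \<otimes> d \<oplus> c \<otimes> b) (b \<otimes> d)"
    if "(a', b') \<in> fraction R a b" "(c', d') \<in> fraction R c d" for a' b' c' d'
  proof -
    have h: "a' \<in> carrier R" "b' \<in> carrier R - {\<zero>}" "c' \<in> carrier R" "d' \<in> carrier R - {\<zero>}"
      "a \<otimes> b' = a' \<otimes> b" "c \<otimes> d' = c' \<otimes> d"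
      using that by (auto simp: fraction_def)
    have "(a' \<otimes> d' \<oplus> c' \<otimes> b') \<otimes> (b \<otimes> d) = (a' \<otimes> b) \<otimes> (d \<otimes> d') \<oplus> (c' \<otimes> d) \<otimes> (b \<otimes> b')"
      using assms h(1-4) by (simp add: m_ac l_distr r_distr)
    also have "\<dots> = (a \<otimes> d \<oplus> c \<otimes> b) \<otimes> (b' \<otimes> d')"
      unfolding h(5,6)[symmetric] using assms h(1-4) by (simp add: m_ac l_distr r_distr)
    finally show ?thesis
      using assms h mult_nonzero by (subst fraction_eq_iff) auto
  qed
  then show ?thesis
    by (simp add: fraction_field_def
        fraction_union[OF assms, where F = "\<lambda>a b c d. fraction R (a \<otimes> d \<oplus> c \<otimes> b) (b \<otimes> d)"])
qed

lemma fraction_closed: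
  "\<lbrakk>a \<in> carrier R; b \<in> carrier R - {\<zero>}\<rbrakk> \<Longrightarrow> fraction R a b \<in> carrier (fraction_field R)"
  by (auto simp: fraction_field_def)

lemma fraction_cases:
  assumes "x \<in> carrier (fraction_field R)"
  obtains a b where "a \<in> carrier R" "b \<in> carrier R - {\<zero>}" "x = fraction R a b"
  using assms by (auto simp: fraction_field_def)

lemma one_nonzero: "\<one> \<in> carrier R - {\<zero>}"
  by simp

lemma fraction_field_one: "\<one>\<^bsub>fraction_field R\<^esub> = fraction R \<one> \<one>"
  and fraction_field_zero: "\<zero>\<^bsub>fraction_field R\<^esub> = fraction R \<zero> \<one>"
  by (simp_all add: fraction_field_def)

lemmas fraction_simps = fraction_add fraction_mult fraction_eq_iff fraction_closed
  fraction_field_one fraction_field_zero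

lemma cring_fraction_field: "cring (fraction_field R)" (is "cring ?F")
proof (rule cringI)
  show "abelian_group ?F"
  proof (rule abelian_groupI)
    fix x y assume "x \<in> carrier ?F" "y \<in> carrier ?F"
    then obtain a b c d where h: "a \<in> carrier R" "b \<in> carrier R - {\<zero>}" "x = fraction R a b"
      "c \<in> carrier R" "d \<in> carrier R - {\<zero>}" "y = fraction R c d"
      by (metis fraction_cases)
    have bd: "b \<otimes> d \<in> carrier R - {\<zero>}" using mult_nonzero h by blast
    then show "x \<oplus>\<^bsub>?F\<^esub> y \<in> carrier ?F" using h by (auto simp: fraction_simps)
    show "x \<oplus>\<^bsub>?F\<^esub> y = y \<oplus>\<^bsub>?F\<^esub> x" using h by (simp add: fraction_simps m_ac a_ac)
    fix z assume "z \<in> carrier ?F"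
    then obtain e f where z: "e \<in> carrier R" "f \<in> carrier R - {\<zero>}" "z = fraction R e f"
      by (metis fraction_cases)
    have nz: "b \<otimes> d \<in> carrier R - {\<zero>}" "d \<otimes> f \<in> carrier R - {\<zero>}"
      using mult_nonzero h z by blast+
    show "x \<oplus>\<^bsub>?F\<^esub> y \<oplus>\<^bsub>?F\<^esub> z = x \<oplus>\<^bsub>?F\<^esub> (y \<oplus>\<^bsub>?F\<^esub> z)"
      using h z nz by (simp add: fraction_add l_distr r_distr m_ac a_ac)
  next
    show "\<zero>\<^bsub>?F\<^esub> \<in> carrier ?F" by (simp add: fraction_simps)
    fix x assume "x \<in> carrier ?F"
    then obtain a b where h: "a \<in> carrier R" "b \<in> carrier R - {\<zero>}" "x = fraction R a b"
      by (metis fraction_cases)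
    then show "\<zero>\<^bsub>?F\<^esub> \<oplus>\<^bsub>?F\<^esub> x = x" by (simp add: fraction_simps)
    have "fraction R (\<ominus> a) b \<oplus>\<^bsub>?F\<^esub> x = fraction R (\<ominus> a \<otimes> b \<oplus> a \<otimes> b) (b \<otimes> b)"
      using h by (simp add: fraction_add)
    also have "\<ominus> a \<otimes> b \<oplus> a \<otimes> b = \<zero>" using h by (simp add: l_minus l_neg)
    also have "fraction R \<zero> (b \<otimes> b) = \<zero>\<^bsub>?F\<^esub>"
      using h mult_nonzero[of b b] by (simp add: fraction_simps)
    finally show "\<exists>y\<in>carrier ?F. y \<oplus>\<^bsub>?F\<^esub> x = \<zero>\<^bsub>?F\<^esub>"
      using h fraction_closed[of "\<ominus> a" b] by auto
  qed
next
  show "comm_monoid ?F"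
  proof (rule comm_monoidI)
    fix x y assume "x \<in> carrier ?F" "y \<in> carrier ?F"
    then obtain a b c d where h: "a \<in> carrier R" "b \<in> carrier R - {\<zero>}" "x = fraction R a b"
      "c \<in> carrier R" "d \<in> carrier R - {\<zero>}" "y = fraction R c d"
      by (metis fraction_cases)
    have bd: "b \<otimes> d \<in> carrier R - {\<zero>}" using mult_nonzero h by blast
    then show "x \<otimes>\<^bsub>?F\<^esub> y \<in> carrier ?F" using h by (auto simp: fraction_simps)
    show "x \<otimes>\<^bsub>?F\<^esub> y = y \<otimes>\<^bsub>?F\<^esub> x" using h by (simp add: fraction_simps m_ac)
    fix z assume "z \<in> carrier ?F"
    then obtain e f where z: "e \<in> carrier R" "f \<in> carrier R - {\<zero>}" "z = fraction R e f"
      by (metis fraction_cases)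
    have nz: "b \<otimes> d \<in> carrier R - {\<zero>}" "d \<otimes> f \<in> carrier R - {\<zero>}"
      using mult_nonzero h z by blast+
    show "x \<otimes>\<^bsub>?F\<^esub> y \<otimes>\<^bsub>?F\<^esub> z = x \<otimes>\<^bsub>?F\<^esub> (y \<otimes>\<^bsub>?F\<^esub> z)"
      using h z nz by (simp add: fraction_mult m_ac)
  next
    show "\<one>\<^bsub>?F\<^esub> \<in> carrier ?F" by (simp add: fraction_simps)
    fix x assume "x \<in> carrier ?F"
    then show "\<one>\<^bsub>?F\<^esub> \<otimes>\<^bsub>?F\<^esub> x = x"
      by (metis fraction_cases fraction_field_one fraction_mult l_one one_closed one_nonzero DiffD1)
  qed
next
  fix x y z assume "x \<in> carrier ?F" "y \<in> carrier ?F" "z \<in> carrier ?F"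
  then obtain a b c d e f where h: "a \<in> carrier R" "b \<in> carrier R - {\<zero>}" "x = fraction R a b"
    "c \<in> carrier R" "d \<in> carrier R - {\<zero>}" "y = fraction R c d"
    "e \<in> carrier R" "f \<in> carrier R - {\<zero>}" "z = fraction R e f"
    by (metis fraction_cases)
  have nz: "b \<otimes> d \<in> carrier R - {\<zero>}" "b \<otimes> f \<in> carrier R - {\<zero>}" "d \<otimes> f \<in> carrier R - {\<zero>}"
    using mult_nonzero h by blast+
  have nz': "b \<otimes> d \<otimes> f \<in> carrier R - {\<zero>}" "b \<otimes> f \<otimes> (d \<otimes> f) \<in> carrier R - {\<zero>}"
    using mult_nonzero h nz by blast+
  show "(x \<oplus>\<^bsub>?F\<^esub> y) \<otimes>\<^bsub>?F\<^esub> z = x \<otimes>\<^bsub>?F\<^esub> z \<oplus>\<^bsub>?F\<^esub> y \<otimes>\<^bsub>?F\<^esub> z"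
    using h nz nz' by (simp add: fraction_simps l_distr r_distr m_ac)
qed

lemma fraction_embedding_hom: "fraction_embedding R \<in> ring_hom R (fraction_field R)"
  by (rule ring_hom_memI) (simp_all add: fraction_embedding_def fraction_simps)

lemma inj_fraction_embedding: "inj_on (fraction_embedding R) (carrier R)"
  by (rule inj_onI) (simp add: fraction_embedding_def fraction_simps)

text \<open>The denominator of \<open>x\<close> serves as \<open>d\<close>. Statements over the
  field of fractions are pulled back to the domain through this property.\<close>

lemma fraction_embedding_clear:
  assumes "x \<in> carrier (fraction_field R)"
  obtains a d where "a \<in> carrier R" "d \<in> carrier R - {\<zero>}"
    "fraction_embedding R d \<otimes>\<^bsub>fraction_field R\<^esub> x = fraction_embedding R a"
proof -
  obtain a b where h: "a \<in> carrier R" "b \<in> carrier R - {\<zero>}" "x = fraction R a b"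
    using assms by (metis fraction_cases)
  then have "fraction_embedding R b \<otimes>\<^bsub>fraction_field R\<^esub> x = fraction_embedding R a"
    by (simp add: fraction_embedding_def fraction_simps m_ac)
  then show ?thesis using that h by blast
qed

end

section \<open>Extension of scalars along a central subring\<close>

text \<open>Additivity in the function instead of the argument. The product of
  \<open>pair_ring\<close> nests its second factor inside the function of the outer
  \<open>frag_extend\<close>, so right distributivity needs this form.\<close>

lemma frag_extend_pointwise_diff:
  "frag_extend (\<lambda>x. f x - g x) p = frag_extend f p - frag_extend g p"
  using subset_UNIV by (induction p rule: frag_induction) (auto simp: frag_extend_diff)

locale scalar_extension = R?: ring R + U?: cring U
  for R :: "('k, 'a, 'm) module_scheme" (structure) and U :: "('g, 'h) ring_scheme" +
  fixes A :: "('a, 'l) ring_scheme" and \<beta> :: "'a \<Rightarrow> 'g"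
  assumes central_subset: "carrier A \<subseteq> carrier R"
    and central: "\<lbrakk>a \<in> carrier A; r \<in> carrier R\<rbrakk> \<Longrightarrow> a \<otimes> r = r \<otimes> a"
    and structure_map_closed: "a \<in> carrier A \<Longrightarrow> \<beta> a \<in> carrier U"
begin

abbreviation P where "P \<equiv> pair_ring R U"
abbreviation N where "N \<equiv> tensor_relations A R U \<beta>"
abbreviation RU where "RU \<equiv> tensor_algebra A R U \<beta>"
abbreviation pure where "pure \<equiv> pure_tensor A R U \<beta>"

lemma pair_ring_simps [simp]:
  "carrier P = {p. Poly_Mapping.keys p \<subseteq> carrier R \<times> carrier U}"
  "\<zero>\<^bsub>P\<^esub> = 0" "p \<oplus>\<^bsub>P\<^esub> q = p + q" "\<one>\<^bsub>P\<^esub> = frag_of (\<one>, \<one>\<^bsub>U\<^esub>)"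
  by (auto simp: pair_ring_def free_Abelian_group_def)

lemma pair_ring_mult:
  "p \<otimes>\<^bsub>P\<^esub> q = frag_extend (\<lambda>(r, u). frag_extend (\<lambda>(s, v). frag_of (r \<otimes> s, u \<otimes>\<^bsub>U\<^esub> v)) q) p"
  by (simp add: pair_ring_def)

lemma pair_ring_mult_of [simp]:
  "frag_of (r, u) \<otimes>\<^bsub>P\<^esub> frag_of (s, v) = frag_of (r \<otimes> s, u \<otimes>\<^bsub>U\<^esub> v)"
  by (simp add: pair_ring_mult)

lemma pair_ring_mult_diff_left: "(p - q) \<otimes>\<^bsub>P\<^esub> w = p \<otimes>\<^bsub>P\<^esub> w - q \<otimes>\<^bsub>P\<^esub> w"
  by (simp add: pair_ring_mult frag_extend_diff)

lemma pair_ring_mult_diff_right: "w \<otimes>\<^bsub>P\<^esub> (p - q) = w \<otimes>\<^bsub>P\<^esub> p - w \<otimes>\<^bsub>P\<^esub> q"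
  by (simp add: pair_ring_mult frag_extend_diff split_def frag_extend_pointwise_diff)

lemma pair_ring_mult_zero [simp]: "0 \<otimes>\<^bsub>P\<^esub> w = 0" "w \<otimes>\<^bsub>P\<^esub> 0 = 0"
  using pair_ring_mult_diff_left[of 0 0 w] pair_ring_mult_diff_right[of w 0 0] by simp_all

lemma pair_ring_mult_add:
  "(p + q) \<otimes>\<^bsub>P\<^esub> w = p \<otimes>\<^bsub>P\<^esub> w + q \<otimes>\<^bsub>P\<^esub> w" "w \<otimes>\<^bsub>P\<^esub> (p + q) = w \<otimes>\<^bsub>P\<^esub> p + w \<otimes>\<^bsub>P\<^esub> q"
  using pair_ring_mult_diff_left[of p "- q" w] pair_ring_mult_diff_left[of 0 q w]
    pair_ring_mult_diff_right[of w p "- q"] pair_ring_mult_diff_right[of w 0 q] by simp_all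

text \<open>The basis generates a free abelian group under differences alone, so one closure case
  covers sums and negatives.\<close>

lemma pair_induct [consumes 1, case_names zero one diff]:
  assumes "p \<in> carrier P" "Q 0"
    "\<And>r u. \<lbrakk>r \<in> carrier R; u \<in> carrier U\<rbrakk> \<Longrightarrow> Q (frag_of (r, u))"
    "\<And>p q. \<lbrakk>Q p; Q q\<rbrakk> \<Longrightarrow> Q (p - q)"
  shows "Q p"
proof (rule frag_induction[where S = "carrier R \<times> carrier U"])
  show "Poly_Mapping.keys p \<subseteq> carrier R \<times> carrier U" using assms(1) by simp
qed (use assms(2-4) in auto)

lemma pair_diff_closed: "\<lbrakk>p \<in> carrier P; q \<in> carrier P\<rbrakk> \<Longrightarrow> p - q \<in> carrier P"
  using keys_diff[of p q] by auto

lemma pair_of_closed: "\<lbrakk>r \<in> carrier R; u \<in> carrier U\<rbrakk> \<Longrightarrow> frag_of (r, u) \<in> carrier P"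
  by simp

lemma pair_mult_closed:
  assumes p: "p \<in> carrier P" and q: "q \<in> carrier P"
  shows "p \<otimes>\<^bsub>P\<^esub> q \<in> carrier P"
  using p
proof (induction rule: pair_induct)
  case (one r u)
  show ?case
    using q
  proof (induction rule: pair_induct)
    case (diff p q)
    then show ?case unfolding pair_ring_mult_diff_right by (rule pair_diff_closed)
  qed (use one in simp_all)
next
  case (diff p q)
  then show ?case unfolding pair_ring_mult_diff_left by (rule pair_diff_closed)
qed simp

lemma pair_mult_assoc:
  assumes p: "p \<in> carrier P" and q: "q \<in> carrier P" and w: "w \<in> carrier P"
  shows "p \<otimes>\<^bsub>P\<^esub> q \<otimes>\<^bsub>P\<^esub> w = p \<otimes>\<^bsub>P\<^esub> (q \<otimes>\<^bsub>P\<^esub> w)"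
  using p
proof (induction rule: pair_induct)
  case one1: (one r u)
  show ?case
    using q
  proof (induction rule: pair_induct)
    case one2: (one s v)
    show ?case
      using w
      by (induction rule: pair_induct)
        (use one1 one2 in \<open>simp_all add: pair_ring_mult_diff_right R.m_assoc U.m_assoc\<close>)
  qed (simp_all add: pair_ring_mult_diff_right pair_ring_mult_diff_left)
qed (simp_all add: pair_ring_mult_diff_left)

lemma add_monoid_pair_ring: "add_monoid P = free_Abelian_group (carrier R \<times> carrier U)"
  by (simp add: pair_ring_def free_Abelian_group_def)

lemma ring_pair_ring: "ring P"
proof (rule ringI)
  show "abelian_group P"
    by (rule comm_group_abelian_groupI, unfold add_monoid_pair_ring, rule abelian_free_Abelian_group)
  show "Group.monoid P"
  proof (rule monoidI)
    show "\<one>\<^bsub>P\<^esub> \<in> carrier P" by simp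
    fix p assume "p \<in> carrier P"
    then show "\<one>\<^bsub>P\<^esub> \<otimes>\<^bsub>P\<^esub> p = p"
      by (induction rule: pair_induct) (simp_all add: pair_ring_mult_diff_right)
  next
    fix p assume "p \<in> carrier P"
    then show "p \<otimes>\<^bsub>P\<^esub> \<one>\<^bsub>P\<^esub> = p"
      by (induction rule: pair_induct) (simp_all add: pair_ring_mult_diff_left)
  qed (use pair_mult_closed pair_mult_assoc in blast)+
qed (simp_all add: pair_ring_mult_add)

section \<open>The tensor relations form a two-sided ideal\<close>

lemma pair_subgroupI:
  assumes "H \<subseteq> carrier P" "0 \<in> H" "\<And>p q. \<lbrakk>p \<in> H; q \<in> H\<rbrakk> \<Longrightarrow> p - q \<in> H"
  shows "subgroup H (add_monoid P)"
proof (rule subgroup.intro)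
  show "H \<subseteq> carrier (add_monoid P)" using assms(1) by simp
  show "\<one>\<^bsub>add_monoid P\<^esub> \<in> H" using assms(2) by simp
  have neg: "- p \<in> H" if "p \<in> H" for p using assms(3)[OF assms(2) that] by simp
  then show "x \<otimes>\<^bsub>add_monoid P\<^esub> y \<in> H" if "x \<in> H" "y \<in> H" for x y
    using assms(3)[OF that(1) neg[OF that(2)]] by simp
  show "inv\<^bsub>add_monoid P\<^esub> x \<in> H" if "x \<in> H" for x
    using that assms(1) neg unfolding add_monoid_pair_ring by (subst inv_free_Abelian_group) auto
qed

lemma relations_subgroup: "subgroup N (add_monoid P)"
proof -
  have left: "frag_of (r \<oplus> s, u) - frag_of (r, u) - frag_of (s, u) \<in> carrier P"
    if "r \<in> carrier R" "s \<in> carrier R" "u \<in> carrier U" for r s u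
    using that by (intro pair_diff_closed pair_of_closed R.add.m_closed)
  have right: "frag_of (r, u \<oplus>\<^bsub>U\<^esub> v) - frag_of (r, u) - frag_of (r, v) \<in> carrier P"
    if "r \<in> carrier R" "u \<in> carrier U" "v \<in> carrier U" for r u v
    using that by (intro pair_diff_closed pair_of_closed U.add.m_closed)
  have balanced: "frag_of (r \<otimes> a, u) - frag_of (r, \<beta> a \<otimes>\<^bsub>U\<^esub> u) \<in> carrier P"
    if "r \<in> carrier R" "a \<in> carrier A" "u \<in> carrier U" for r a u
    using that central_subset structure_map_closed
    by (intro pair_diff_closed pair_of_closed R.m_closed U.m_closed) auto
  have carrier: "carrier P = carrier (free_Abelian_group (carrier R \<times> carrier U))"
    by (simp add: pair_ring_def)
  show ?thesis
    unfolding tensor_relations_def add_monoid_pair_ring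
    by (intro group.generate_is_subgroup group_free_Abelian_group Un_least subsetI,
        unfold carrier[symmetric]; elim CollectE exE conjE; hypsubst)
      (rule left right balanced; assumption)+
qed

lemma relations_closed: "p \<in> N \<Longrightarrow> p \<in> carrier P"
  using subgroup.mem_carrier[OF relations_subgroup, of p] by simp

lemma relations_zero: "0 \<in> N"
  using subgroup.one_closed[OF relations_subgroup] by simp

lemma relations_diff:
  assumes "p \<in> N" "q \<in> N" shows "p - q \<in> N"
proof -
  have "- q \<in> N"
    using subgroup.m_inv_closed[OF relations_subgroup assms(2)] relations_closed[OF assms(2)]
    unfolding add_monoid_pair_ring by simp
  then show ?thesis using subgroup.m_closed[OF relations_subgroup assms(1)] by force
qed

lemma relations_add: "\<lbrakk>p \<in> N; q \<in> N\<rbrakk> \<Longrightarrow> p + q \<in> N"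
  using relations_diff[of p "0 - q"] relations_diff[OF relations_zero, of q] by simp

lemma relations_gen:
  "\<lbrakk>r \<in> carrier R; s \<in> carrier R; u \<in> carrier U\<rbrakk>
    \<Longrightarrow> frag_of (r \<oplus> s, u) - frag_of (r, u) - frag_of (s, u) \<in> N"
  "\<lbrakk>r \<in> carrier R; u \<in> carrier U; v \<in> carrier U\<rbrakk>
    \<Longrightarrow> frag_of (r, u \<oplus>\<^bsub>U\<^esub> v) - frag_of (r, u) - frag_of (r, v) \<in> N"
  "\<lbrakk>r \<in> carrier R; a \<in> carrier A; u \<in> carrier U\<rbrakk>
    \<Longrightarrow> frag_of (r \<otimes> a, u) - frag_of (r, \<beta> a \<otimes>\<^bsub>U\<^esub> u) \<in> N"
  unfolding tensor_relations_def by (rule generate.incl; blast)+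

text \<open>The elements of \<open>carrier P\<close> satisfying \<open>Q\<close> form a subgroup
  containing the generators, hence all of \<open>N\<close>. Carrier membership is kept in the
  \<open>diff\<close> case because homomorphisms out of the free group are additive only
  there.\<close>

lemma relations_induct [consumes 1, case_names left right balanced zero diff]:
  assumes "p \<in> N"
    "\<And>r s u. \<lbrakk>r \<in> carrier R; s \<in> carrier R; u \<in> carrier U\<rbrakk>
      \<Longrightarrow> Q (frag_of (r \<oplus> s, u) - frag_of (r, u) - frag_of (s, u))"
    "\<And>r u v. \<lbrakk>r \<in> carrier R; u \<in> carrier U; v \<in> carrier U\<rbrakk>
      \<Longrightarrow> Q (frag_of (r, u \<oplus>\<^bsub>U\<^esub> v) - frag_of (r, u) - frag_of (r, v))"
    "\<And>r a u. \<lbrakk>r \<in> carrier R; a \<in> carrier A; u \<in> carrier U\<rbrakk>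
      \<Longrightarrow> Q (frag_of (r \<otimes> a, u) - frag_of (r, \<beta> a \<otimes>\<^bsub>U\<^esub> u))"
    "Q 0" "\<And>p q. \<lbrakk>p \<in> carrier P; q \<in> carrier P; Q p; Q q\<rbrakk> \<Longrightarrow> Q (p - q)"
  shows "Q p"
proof -
  let ?H = "{p \<in> carrier P. Q p}"
  have subgroup: "subgroup ?H (add_monoid P)"
  proof (rule pair_subgroupI)
    show "p - q \<in> ?H" if "p \<in> ?H" "q \<in> ?H" for p q
      using that pair_diff_closed[of p q] assms(6)[of p q] by blast
  qed (use assms(5) in auto)
  have mem: "p \<in> ?H" if "Q p" "p \<in> N" for p
    using that relations_closed by blast
  have group: "group (add_monoid P)"
    by (simp only: add_monoid_pair_ring group_free_Abelian_group)
  have "N \<subseteq> ?H"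
    unfolding tensor_relations_def[of A R U]
    by (intro group.generate_subgroup_incl[OF group _ subgroup] Un_least subsetI;
        elim CollectE exE conjE; hypsubst)
      (rule mem, rule assms(2-4); (assumption | rule relations_gen; assumption))+
  then show ?thesis using assms(1) by blast
qed

lemma relations_mult_left:
  assumes w: "w \<in> carrier P" and p: "p \<in> N"
  shows "w \<otimes>\<^bsub>P\<^esub> p \<in> N"
  using w
proof (induction rule: pair_induct)
  case one: (one s v)
  show ?case
    using p
  proof (induction rule: relations_induct)
    case (left r s u)
    then show ?case
      using relations_gen(1) one by (simp add: pair_ring_mult_diff_right R.r_distr)
  next
    case (right r u v)
    then show ?case
      using relations_gen(2) one by (simp add: pair_ring_mult_diff_right U.r_distr)
  next
    case (balanced r a u)
    then have "v \<otimes>\<^bsub>U\<^esub> (\<beta> a \<otimes>\<^bsub>U\<^esub> u) = \<beta> a \<otimes>\<^bsub>U\<^esub> (v \<otimes>\<^bsub>U\<^esub> u)"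
      using one structure_map_closed by (simp add: U.m_lcomm)
    moreover have "s \<otimes> (r \<otimes> a) = s \<otimes> r \<otimes> a"
      using balanced one central_subset by (simp add: R.m_assoc subset_iff)
    ultimately show ?case
      using relations_gen(3)[of "s \<otimes> r" a "v \<otimes>\<^bsub>U\<^esub> u"] one balanced by (simp add: pair_ring_mult_diff_right)
  qed (simp_all add: pair_ring_mult_diff_right relations_zero relations_diff)
qed (simp_all add: pair_ring_mult_diff_left relations_zero relations_diff)

lemma relations_mult_right:
  assumes w: "w \<in> carrier P" and p: "p \<in> N"
  shows "p \<otimes>\<^bsub>P\<^esub> w \<in> N"
  using w
proof (induction rule: pair_induct)
  case one: (one s v)
  show ?case
    using p
  proof (induction rule: relations_induct)
    case (left r s u)
    then show ?case
      using relations_gen(1) one by (simp add: pair_ring_mult_diff_left R.l_distr)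
  next
    case (right r u v)
    then show ?case
      using relations_gen(2) one by (simp add: pair_ring_mult_diff_left U.l_distr)
  next
    case (balanced r a u)
    then have "\<beta> a \<otimes>\<^bsub>U\<^esub> u \<otimes>\<^bsub>U\<^esub> v = \<beta> a \<otimes>\<^bsub>U\<^esub> (u \<otimes>\<^bsub>U\<^esub> v)"
      using one structure_map_closed by (simp add: U.m_assoc)
    \<comment> \<open>Centrality of \<open>A\<close> enters here: \<open>a\<close> has to pass
      \<open>s\<close> before the product is again a balancing relation.\<close>
    moreover have "r \<otimes> a \<otimes> s = r \<otimes> s \<otimes> a"
      using balanced one central_subset central[of a s] by (simp add: R.m_assoc subset_iff)
    ultimately show ?case
      using relations_gen(3)[of "r \<otimes> s" a "u \<otimes>\<^bsub>U\<^esub> v"] one balanced by (simp add: pair_ring_mult_diff_left)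
  qed (simp_all add: pair_ring_mult_diff_left relations_zero relations_diff)
qed (simp_all add: pair_ring_mult_diff_right relations_zero relations_diff)

lemma relations_ideal: "ideal N P"
  using ring_pair_ring relations_subgroup relations_mult_left relations_mult_right
  by (intro idealI)

end

text \<open>\<open>tensor_algebra\<close> copies the fields of the quotient ring into a larger
  record with a scalar action, so the ring axioms must be carried over field by field.\<close>

lemma ring_from_components:
  assumes "ring Q" "carrier R = carrier Q" "monoid.mult R = monoid.mult Q" "one R = one Q"
    "ring.zero R = ring.zero Q" "ring.add R = ring.add Q"
  shows "ring R"
proof -
  interpret Q: ring Q by fact
  show ?thesis
  proof (rule ringI)
    show "abelian_group R"
      by (rule abelian_groupI)
        (use Q.l_neg Q.a_inv_closed in \<open>auto simp: assms(2-6) Q.a_ac\<close>)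
    show "Group.monoid R"
      by (rule monoidI) (simp_all add: assms(2-6) Q.m_assoc)
  qed (simp_all add: assms(2-6) Q.l_distr Q.r_distr)
qed

section \<open>Calculus of cosets and pure tensors\<close>

context scalar_extension
begin

definition cls where "cls p = N +>\<^bsub>P\<^esub> p"

lemma tensor_algebra_simps:
  "carrier RU = a_rcosets\<^bsub>P\<^esub> N" "\<one>\<^bsub>RU\<^esub> = cls \<one>\<^bsub>P\<^esub>" "\<zero>\<^bsub>RU\<^esub> = N"
  "c \<odot>\<^bsub>RU\<^esub> x = tensor_lift A R U \<beta> (\<lambda>(r, u). (c \<odot>\<^bsub>R\<^esub> r, u)) x"
  by (simp_all add: tensor_algebra_def Let_def FactRing_def cls_def)

lemma ring_tensor_algebra: "ring RU"
  by (rule ring_from_components[OF ideal.quotient_is_ring[OF relations_ideal]])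
    (simp_all add: tensor_algebra_def Let_def)

lemma cls_closed: "p \<in> carrier P \<Longrightarrow> cls p \<in> carrier RU"
  unfolding tensor_algebra_simps cls_def
  using abelian_group.a_rcosetsI[OF ring.is_abelian_group[OF ring_pair_ring]] relations_closed
  by (meson subsetI)

lemma cls_cases:
  assumes "x \<in> carrier RU"
  obtains p where "p \<in> carrier P" "x = cls p"
  using assms unfolding tensor_algebra_simps A_RCOSETS_def' a_r_coset_def' cls_def by blast

lemma cls_add: "\<lbrakk>p \<in> carrier P; q \<in> carrier P\<rbrakk> \<Longrightarrow> cls p \<oplus>\<^bsub>RU\<^esub> cls q = cls (p + q)"
  using ideal.a_rcos_sum[OF relations_ideal, of p q]
  by (simp add: tensor_algebra_def Let_def FactRing_def cls_def)

lemma cls_mult: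
  "\<lbrakk>p \<in> carrier P; q \<in> carrier P\<rbrakk> \<Longrightarrow> cls p \<otimes>\<^bsub>RU\<^esub> cls q = cls (p \<otimes>\<^bsub>P\<^esub> q)"
  using ideal.rcoset_mult_add[OF relations_ideal, of p q]
  by (simp add: tensor_algebra_def Let_def FactRing_def cls_def)

lemma cls_def': "cls p = (\<lambda>h. h + p) ` N"
  unfolding cls_def a_r_coset_def' by (auto simp: image_iff)

lemma cls_eq_iff: "cls p = cls q \<longleftrightarrow> p - q \<in> N"
proof
  assume "cls p = cls q"
  moreover have "p \<in> cls p" using relations_zero unfolding cls_def' by force
  ultimately have "p \<in> cls q" by simp
  then show "p - q \<in> N" unfolding cls_def' by auto
next
  have sub: "cls p \<subseteq> cls q" if "p - q \<in> N" for p q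
  proof
    fix x assume "x \<in> cls p"
    then obtain h where "h \<in> N" "x = h + p" unfolding cls_def' by blast
    then have "x = (h + (p - q)) + q" "h + (p - q) \<in> N"
      using that relations_add by simp_all
    then show "x \<in> cls q" unfolding cls_def' by blast
  qed
  assume "p - q \<in> N"
  moreover from relations_diff[OF relations_zero this] have "q - p \<in> N" by simp
  ultimately show "cls p = cls q" using sub by blast
qed

lemma pure_eq_cls: "pure r u = cls (frag_of (r, u))"
  by (simp add: pure_tensor_def cls_def)

lemma pure_closed [simp]: "\<lbrakk>r \<in> carrier R; u \<in> carrier U\<rbrakk> \<Longrightarrow> pure r u \<in> carrier RU"
  unfolding pure_eq_cls by (intro cls_closed pair_of_closed)

lemma pure_one: "\<one>\<^bsub>RU\<^esub> = pure \<one> \<one>\<^bsub>U\<^esub>"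
  by (simp add: tensor_algebra_simps pure_eq_cls)

lemma pure_mult:
  "\<lbrakk>r \<in> carrier R; u \<in> carrier U; s \<in> carrier R; v \<in> carrier U\<rbrakk>
    \<Longrightarrow> pure r u \<otimes>\<^bsub>RU\<^esub> pure s v = pure (r \<otimes> s) (u \<otimes>\<^bsub>U\<^esub> v)"
  by (simp add: pure_eq_cls cls_mult)

lemma pure_add_left:
  "\<lbrakk>r \<in> carrier R; s \<in> carrier R; u \<in> carrier U\<rbrakk>
    \<Longrightarrow> pure r u \<oplus>\<^bsub>RU\<^esub> pure s u = pure (r \<oplus> s) u"
  using relations_gen(1)[of r s u]
  by (simp add: pure_eq_cls cls_add eq_commute[of _ "cls (frag_of (r \<oplus> s, u))"] cls_eq_iff
      diff_diff_eq)

lemma pure_add_right: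
  "\<lbrakk>r \<in> carrier R; u \<in> carrier U; v \<in> carrier U\<rbrakk>
    \<Longrightarrow> pure r u \<oplus>\<^bsub>RU\<^esub> pure r v = pure r (u \<oplus>\<^bsub>U\<^esub> v)"
  using relations_gen(2)[of r u v]
  by (simp add: pure_eq_cls cls_add eq_commute[of _ "cls (frag_of (r, u \<oplus>\<^bsub>U\<^esub> v))"] cls_eq_iff
      diff_diff_eq)

lemma pure_balanced:
  "\<lbrakk>r \<in> carrier R; a \<in> carrier A; u \<in> carrier U\<rbrakk>
    \<Longrightarrow> pure (r \<otimes> a) u = pure r (\<beta> a \<otimes>\<^bsub>U\<^esub> u)"
  using relations_gen(3) by (simp add: pure_eq_cls cls_eq_iff)

lemma pure_zero_left:
  assumes "u \<in> carrier U"
  shows "pure \<zero> u = \<zero>\<^bsub>RU\<^esub>"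
proof -
  interpret T: ring RU by (rule ring_tensor_algebra)
  show ?thesis using assms pure_add_left[of \<zero> \<zero> u] T.add.l_cancel_one by simp
qed

lemma pure_minus:
  "\<lbrakk>r \<in> carrier R; u \<in> carrier U\<rbrakk> \<Longrightarrow> \<ominus>\<^bsub>RU\<^esub> pure r u = pure (\<ominus> r) u"
proof -
  interpret T: ring RU by (rule ring_tensor_algebra)
  assume h: "r \<in> carrier R" "u \<in> carrier U"
  then have "pure (\<ominus> r) u \<oplus>\<^bsub>RU\<^esub> pure r u = \<zero>\<^bsub>RU\<^esub>"
    by (simp add: pure_add_left R.l_neg pure_zero_left)
  then show ?thesis using h T.minus_equality by simp
qed

text \<open>Pure tensors generate additively, and zero is itself the pure tensor with first factor
  \<open>\<zero>\<close>, so closure under differences suffices.\<close>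

lemma tensor_induct [consumes 1, case_names pure diff]:
  assumes "x \<in> carrier RU"
    "\<And>r u. \<lbrakk>r \<in> carrier R; u \<in> carrier U\<rbrakk> \<Longrightarrow> Q (pure r u)"
    "\<And>x y. \<lbrakk>x \<in> carrier RU; y \<in> carrier RU; Q x; Q y\<rbrakk> \<Longrightarrow> Q (x \<ominus>\<^bsub>RU\<^esub> y)"
  shows "Q x"
proof -
  interpret T: ring RU by (rule ring_tensor_algebra)
  obtain p where p: "p \<in> carrier P" "x = cls p" using assms(1) by (rule cls_cases)
  from p(1) have "p \<in> carrier P \<and> Q (cls p)"
  proof (induction rule: pair_induct)
    case zero
    have "cls 0 = \<zero>\<^bsub>RU\<^esub>" by (simp add: cls_def' tensor_algebra_simps)
    then show ?case using assms(2)[of \<zero> "\<one>\<^bsub>U\<^esub>"] by (simp add: pure_zero_left)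
  next
    case (one r u)
    then show ?case using assms(2)[of r u] by (simp add: pure_eq_cls)
  next
    case (diff p q)
    then have c: "cls p \<in> carrier RU" "cls q \<in> carrier RU" "cls (p - q) \<in> carrier RU"
      and pq: "p - q \<in> carrier P"
      using cls_closed pair_diff_closed by blast+
    have "cls (p - q) \<oplus>\<^bsub>RU\<^esub> cls q = cls p" using cls_add[OF pq, of q] diff by simp
    then have "cls (p - q) = cls p \<ominus>\<^bsub>RU\<^esub> cls q"
      using c by (metis T.add.inv_solve_right T.minus_eq)
    then show ?case using assms(3)[of "cls p" "cls q"] c diff pq by simp
  qed
  then show ?thesis using p by simp
qed

text \<open>An additive \<open>f\<close> that commutes with right multiplication by \<open>A\<close>
  sends each defining relation to a relation of the same kind. All representatives of a coset
  therefore give the same class. Applied to the trace and to the ground field action.\<close>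

lemma tensor_lift_pure:
  assumes closed: "\<And>r. r \<in> carrier R \<Longrightarrow> f r \<in> carrier R"
    and add: "\<And>r s. \<lbrakk>r \<in> carrier R; s \<in> carrier R\<rbrakk> \<Longrightarrow> f (r \<oplus> s) = f r \<oplus> f s"
    and lin: "\<And>r a. \<lbrakk>r \<in> carrier R; a \<in> carrier A\<rbrakk> \<Longrightarrow> f (r \<otimes> a) = f r \<otimes> a"
    and ru: "r \<in> carrier R" "u \<in> carrier U"
  shows "tensor_lift A R U \<beta> (\<lambda>(r, u). (f r, u)) (pure r u) = pure (f r) u"
proof -
  let ?F = "frag_extend (frag_of \<circ> (\<lambda>(r, u). (f r, u)))"
  have N: "?F p \<in> N" if "p \<in> N" for p
    using that
  proof (induction rule: relations_induct)
    case (left r s u)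
    then show ?case using relations_gen(1)[of "f r" "f s" u] by (simp add: frag_extend_diff add closed)
  next
    case (right r u v)
    then show ?case using relations_gen(2)[of "f r" u v] by (simp add: frag_extend_diff closed)
  next
    case (balanced r a u)
    then show ?case using relations_gen(3)[of "f r" a u] by (simp add: frag_extend_diff lin closed)
  next
    case zero
    show ?case by (simp add: relations_zero)
  next
    case (diff p q)
    then show ?case unfolding frag_extend_diff by (intro relations_diff)
  qed
  have "cls (?F p) = pure (f r) u" if "p \<in> pure r u" for p
  proof -
    obtain h where "h \<in> N" "p = h + frag_of (r, u)"
      using \<open>p \<in> pure r u\<close> unfolding pure_eq_cls cls_def' by blast
    then show ?thesis using N by (simp add: pure_eq_cls cls_eq_iff frag_extend_add)
  qed
  \<comment> \<open>The lift is a union of equal sets; it equals their common value only if the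
    index set is nonempty.\<close>
  moreover have "pure r u \<noteq> {}" using relations_zero unfolding pure_eq_cls cls_def' by blast
  ultimately show ?thesis unfolding tensor_lift_def cls_def[symmetric] by auto
qed

end

text \<open>Keeps the dot for integer multiples: with both notations, \<open>[m] \<cdot> x\<close>
  can also be parsed as an ideal product involving the list \<open>[m]\<close>.\<close>

no_notation ideal_prod (infixl \<open>\<cdot>\<index>\<close> 80)

section \<open>Nil ideals of bounded index\<close>

lemma (in ring) ideal_by_closure:
  assumes "S \<subseteq> carrier R" "\<zero> \<in> S" "\<And>x y. \<lbrakk>x \<in> S; y \<in> S\<rbrakk> \<Longrightarrow> x \<oplus> y \<in> S"
    "\<And>r x. \<lbrakk>r \<in> carrier R; x \<in> S\<rbrakk> \<Longrightarrow> r \<otimes> x \<in> S"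
    "\<And>r x. \<lbrakk>r \<in> carrier R; x \<in> S\<rbrakk> \<Longrightarrow> x \<otimes> r \<in> S"
  shows "ideal S R"
proof (rule idealI)
  have "\<ominus> x \<in> S" if "x \<in> S" for x
    using assms(4)[of "\<ominus> \<one>" x] that assms(1) by (simp add: l_minus subset_iff)
  then show "subgroup S (add_monoid R)"
    using assms(1-3) by (intro add.subgroupI) (auto simp: a_inv_def)
qed (use assms ring_axioms in auto)

text \<open>Characteristic zero as seen by the additive group. The nil argument involves only
  integer multiples, so it can run without the ground field.\<close>

definition torsion_free :: "('a, 'm) ring_scheme \<Rightarrow> bool"
  where "torsion_free R \<longleftrightarrow> (\<forall>m x. 0 < (m::nat) \<and> x \<in> carrier R \<and> [m] \<cdot>\<^bsub>R\<^esub> x = \<zero>\<^bsub>R\<^esub> \<longrightarrow> x = \<zero>\<^bsub>R\<^esub>)"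

text \<open>The coefficient of \<open>\<lambda>\<^sup>i\<close> in \<open>(a + \<lambda> y)\<^sup>k\<close>.\<close>

primrec power_coeff :: "('a, 'm) ring_scheme \<Rightarrow> 'a \<Rightarrow> 'a \<Rightarrow> nat \<Rightarrow> nat \<Rightarrow> 'a"
  where
    "power_coeff R a y 0 = (\<lambda>i. if i = 0 then \<one>\<^bsub>R\<^esub> else \<zero>\<^bsub>R\<^esub>)"
  | "power_coeff R a y (Suc k) = (\<lambda>i. power_coeff R a y k i \<otimes>\<^bsub>R\<^esub> a \<oplus>\<^bsub>R\<^esub>
      (case i of 0 \<Rightarrow> \<zero>\<^bsub>R\<^esub> | Suc j \<Rightarrow> power_coeff R a y k j \<otimes>\<^bsub>R\<^esub> y))"

context ring
begin

lemma power_coeff_closed [simp]: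
  "\<lbrakk>a \<in> carrier R; y \<in> carrier R\<rbrakk> \<Longrightarrow> power_coeff R a y k i \<in> carrier R"
  by (induction k arbitrary: i) (auto split: nat.splits)

lemma power_coeff_0 [simp]: "a \<in> carrier R \<Longrightarrow> power_coeff R a y k 0 = a [^] k"
  by (induction k) simp_all

lemma power_coeff_beyond:
  "\<lbrakk>a \<in> carrier R; y \<in> carrier R; k < i\<rbrakk> \<Longrightarrow> power_coeff R a y k i = \<zero>"
  by (induction k arbitrary: i) (auto split: nat.splits)

text \<open>\<open>a\<close> and \<open>y\<close> need not commute, but the integer \<open>m\<close>
  commutes with both, so the terms can be collected by their degree in \<open>m\<close>.\<close>

lemma power_expansion:
  fixes m :: nat
  assumes "a \<in> carrier R" "y \<in> carrier R"
  shows "(a \<oplus> [m] \<cdot> y) [^] k = (\<Oplus>i\<in>{..k}. [(m ^ i)] \<cdot> power_coeff R a y k i)"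
proof (induction k)
  case 0
  then show ?case by simp
next
  case (Suc k)
  let ?C = "power_coeff R a y k"
  let ?D = "\<lambda>i. case i of 0 \<Rightarrow> \<zero> | Suc j \<Rightarrow> ?C j \<otimes> y"
  have D: "?D i \<in> carrier R" for i using assms by (auto split: nat.splits)
  have c: "[l] \<cdot> ?C i \<in> carrier R" "[l] \<cdot> (?C i \<otimes> a) \<in> carrier R" "[l] \<cdot> (?C i \<otimes> y) \<in> carrier R"
    for l i :: nat using assms by simp_all
  have "(a \<oplus> [m] \<cdot> y) [^] Suc k
    = (\<Oplus>i\<in>{..k}. [(m ^ i)] \<cdot> ?C i) \<otimes> a \<oplus> (\<Oplus>i\<in>{..k}. [(m ^ i)] \<cdot> ?C i) \<otimes> ([m] \<cdot> y)"
    using assms c by (simp add: Suc r_distr finsum_closed Pi_def)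
  also have "(\<Oplus>i\<in>{..k}. [(m ^ i)] \<cdot> ?C i) \<otimes> a = (\<Oplus>i\<in>{..k}. [(m ^ i)] \<cdot> (?C i \<otimes> a))"
    using assms c by (subst finsum_ldistr) (auto simp: add_pow_ldistr Pi_def)
  \<comment> \<open>The added top term is zero by \<open>power_coeff_beyond\<close>; both sums must
    have the same range before they are merged.\<close>
  also have "(\<Oplus>i\<in>{..k}. [(m ^ i)] \<cdot> (?C i \<otimes> a)) = (\<Oplus>i\<in>{..Suc k}. [(m ^ i)] \<cdot> (?C i \<otimes> a))"
    using assms c by (simp add: power_coeff_beyond Pi_def)
  also have "(\<Oplus>i\<in>{..k}. [(m ^ i)] \<cdot> ?C i) \<otimes> ([m] \<cdot> y) = (\<Oplus>i\<in>{..k}. [(m ^ Suc i)] \<cdot> (?C i \<otimes> y))"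
    using assms c
    by (subst finsum_ldistr) (auto simp: add_pow_ldistr add_pow_rdistr Pi_def add.nat_pow_pow mult.commute)
  \<comment> \<open>Shifts the index by one; the new term at 0 is
    \<open>?D 0 = \<zero>\<close>.\<close>
  also have "\<dots> = (\<Oplus>i\<in>{..Suc k}. [(m ^ i)] \<cdot> ?D i)"
    using assms c D by (subst finsum_Suc2) (auto simp: Pi_def)
  also have "(\<Oplus>i\<in>{..Suc k}. [(m ^ i)] \<cdot> (?C i \<otimes> a)) \<oplus> (\<Oplus>i\<in>{..Suc k}. [(m ^ i)] \<cdot> ?D i)
    = (\<Oplus>i\<in>{..Suc k}. [(m ^ i)] \<cdot> power_coeff R a y (Suc k) i)"
    using assms c D by (subst finsum_addf[symmetric]) (auto simp: Pi_def add.nat_pow_distrib)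
  finally show ?case .
qed

lemma add_pow_finsum:
  "(\<And>i::nat. f i \<in> carrier R) \<Longrightarrow>
    [(l :: nat)] \<cdot> (\<Oplus>i\<in>{..k}. f i) = (\<Oplus>i\<in>{..k}. [l] \<cdot> f i)"
  by (induction k) (simp_all add: Pi_def add.nat_pow_distrib finsum_closed)

text \<open>A Vandermonde argument by elimination: comparing the values at \<open>m\<close> and
  \<open>2 m\<close> removes the top coefficient and multiplies the others by positive integers,
  which torsion-freeness cancels.\<close>

lemma polynomial_coeffs_zero:
  assumes tf: "torsion_free R" and "\<And>i. c i \<in> carrier R"
    and "\<And>m::nat. 0 < m \<Longrightarrow> (\<Oplus>i\<in>{..k}. [(m ^ i)] \<cdot> c i) = \<zero>" and "i \<le> k"
  shows "c i = \<zero>"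
  using assms(2-4)
proof (induction k arbitrary: c i)
  case 0
  from 0(2)[of 1] 0(1,3) show ?case by simp
next
  case (Suc k)
  have cl [simp]: "[l] \<cdot> c i \<in> carrier R" for l i :: nat using Suc(2) by simp
  note Suc(2) [simp]
  \<comment> \<open>With \<open>P(m)\<close> the sum for \<open>c\<close>, these are the
    coefficients of \<open>2^(k+1) P(m) - P(2 m)\<close>. The natural-number subtraction is exact
    for \<open>i \<le> Suc k\<close> and gives zero at \<open>i = Suc k\<close>.\<close>
  define e where "e i = [((2 ^ Suc k - 2 ^ i) :: nat)] \<cdot> c i" for i
  have e [simp]: "e i \<in> carrier R" "[l] \<cdot> e i \<in> carrier R" for l i :: nat by (simp_all add: e_def)
  have "e i = \<zero>" if "i \<le> k" for i
  proof (rule Suc.IH[OF _ _ that])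
    fix m :: nat assume m: "0 < m"
    have split: "[(m ^ i)] \<cdot> e i \<oplus> [((2 * m) ^ i)] \<cdot> c i = [(2 ^ Suc k :: nat)] \<cdot> ([(m ^ i)] \<cdot> c i)"
      if "i \<in> {..Suc k}" for i
    proof -
      have le: "(2::nat) ^ i \<le> 2 ^ Suc k" using that by (intro power_increasing) auto
      have "[(m ^ i)] \<cdot> e i \<oplus> [((2 * m) ^ i)] \<cdot> c i
          = [((2 ^ Suc k - 2 ^ i) * m ^ i + (2 * m) ^ i)] \<cdot> c i"
        by (simp add: e_def add.nat_pow_pow add.nat_pow_mult)
      also have "(2 ^ Suc k - 2 ^ i) * m ^ i + (2 * m) ^ i = m ^ i * 2 ^ Suc k"
        using le by (simp add: power_mult_distrib mult.commute flip: add_mult_distrib2)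
      finally show ?thesis by (simp add: add.nat_pow_pow)
    qed
    \<comment> \<open>The range may grow because the coefficient at \<open>Suc k\<close> is
      \<open>[0] \<cdot> c (Suc k)\<close>.\<close>
    have "(\<Oplus>i\<in>{..k}. [(m ^ i)] \<cdot> e i) = (\<Oplus>i\<in>{..Suc k}. [(m ^ i)] \<cdot> e i)"
      by (simp add: e_def)
    also have "\<dots> = (\<Oplus>i\<in>{..Suc k}. [(m ^ i)] \<cdot> e i) \<oplus> (\<Oplus>i\<in>{..Suc k}. [((2 * m) ^ i)] \<cdot> c i)"
      using Suc(3)[of "2 * m"] m by (simp add: finsum_closed Pi_def)
    also have "\<dots> = (\<Oplus>i\<in>{..Suc k}. [(m ^ i)] \<cdot> e i \<oplus> [((2 * m) ^ i)] \<cdot> c i)"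
      by (rule finsum_addf[symmetric]) simp_all
    also have "\<dots> = (\<Oplus>i\<in>{..Suc k}. [(2 ^ Suc k :: nat)] \<cdot> ([(m ^ i)] \<cdot> c i))"
      by (rule finsum_cong'[OF refl _ split]) simp_all
    also have "\<dots> = [(2 ^ Suc k :: nat)] \<cdot> (\<Oplus>i\<in>{..Suc k}. [(m ^ i)] \<cdot> c i)"
      by (rule add_pow_finsum[symmetric]) simp
    also have "\<dots> = \<zero>" using Suc(3)[OF m] by simp
    finally show "(\<Oplus>i\<in>{..k}. [(m ^ i)] \<cdot> e i) = \<zero>" .
  qed simp
  then have low: "c i = \<zero>" if "i \<le> k" for i
    using that tf Suc(2)[of i] power_strict_increasing[of i "Suc k" "2::nat"]
    unfolding torsion_free_def e_def by (metis le_imp_less_Suc one_less_numeral_iff semiring_norm(76) zero_less_diff)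
  \<comment> \<open>With the lower coefficients gone, evaluation at 1 leaves the top coefficient
    alone.\<close>
  have "(\<Oplus>i\<in>{..k}. [(1 ^ i :: nat)] \<cdot> c i) = (\<Oplus>i\<in>{..k}. \<zero>)"
    by (rule finsum_cong') (auto simp: low)
  then have "c (Suc k) = \<zero>" using Suc(3)[of 1] by simp
  then show ?case using low Suc(4) by (cases "i = Suc k") auto
qed

text \<open>Take the least \<open>k\<close> with \<open>x^k = 0\<close> on \<open>J\<close> and
  \<open>b = a^(k-1)\<close> nonzero. The part of \<open>(a + m y)^k\<close> linear in
  \<open>m\<close> vanishes; it is \<open>b y\<close> plus terms ending in \<open>a\<close>.
  Multiplication by \<open>b\<close> from the right kills the latter, since
  \<open>a b = a^k = 0\<close>.\<close>

lemma nil_bounded_index_sandwich: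
  assumes tf: "torsion_free R" and J: "ideal J R" "J \<noteq> {\<zero>}"
    and nil: "\<And>x. x \<in> J \<Longrightarrow> x [^] (n :: nat) = \<zero>"
  obtains b where "b \<in> J" "b \<noteq> \<zero>" "\<And>y. y \<in> J \<Longrightarrow> b \<otimes> y \<otimes> b = \<zero>"
proof -
  interpret J: ideal J R by fact
  define k where "k = (LEAST k. \<forall>x\<in>J. x [^] (k :: nat) = \<zero>)"
  have k: "\<forall>x\<in>J. x [^] k = \<zero>" unfolding k_def by (rule LeastI[of _ n]) (use nil in blast)
  have min: "\<exists>x\<in>J. x [^] l \<noteq> \<zero>" if "l < k" for l
    using not_less_Least[OF that[unfolded k_def]] by blast
  obtain z where z: "z \<in> J" "z \<noteq> \<zero>" using J J.zero_closed by blast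
  \<comment> \<open>The exponents 0 and 1 would force the nonzero \<open>z\<close> to vanish. So
    \<open>k \<ge> 2\<close>, and \<open>b\<close> is a positive power of \<open>a\<close>, which
    keeps it in \<open>J\<close>.\<close>
  have "k \<noteq> 0" using k z J.Icarr by (metis l_one l_null nat_pow_0)
  moreover have "k \<noteq> 1" using k z J.Icarr by (metis One_nat_def l_one nat_pow_0 nat_pow_Suc)
  ultimately obtain j where j: "k = Suc (Suc j)" by (metis One_nat_def not0_implies_Suc)
  obtain a where a: "a \<in> J" "a [^] Suc j \<noteq> \<zero>" using min[of "Suc j"] j by auto
  define b where "b = a [^] Suc j"
  have ac [simp]: "a \<in> carrier R" using a J.Icarr by blast
  have bc [simp]: "b \<in> carrier R" unfolding b_def by simp
  have "b \<in> J" unfolding b_def nat_pow_Suc using a by (simp add: J.I_l_closed)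
  moreover have "b \<noteq> \<zero>" using a b_def by simp
  moreover have "b \<otimes> y \<otimes> b = \<zero>" if y: "y \<in> J" for y
  proof -
    have yc [simp]: "y \<in> carrier R" using y J.Icarr by blast
    have my: "[m] \<cdot> y \<in> J" for m :: nat
      using y by (induction m) (simp_all add: J.zero_closed J.a_closed)
    have "power_coeff R a y k 1 = \<zero>"
    proof (rule polynomial_coeffs_zero[OF tf, where k = k])
      show "(\<Oplus>i\<in>{..k}. [(m ^ i)] \<cdot> power_coeff R a y k i) = \<zero>" for m :: nat
        using k J.a_closed[OF a(1) my] by (simp add: power_expansion[symmetric])
    qed (simp_all add: j del: power_coeff.simps)
    \<comment> \<open>The recursion for the last factor separates the word ending in
      \<open>y\<close> from those ending in \<open>a\<close>.\<close>
    moreover have "power_coeff R a y k 1 = power_coeff R a y (Suc j) 1 \<otimes> a \<oplus> b \<otimes> y"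
      unfolding j by (subst power_coeff.simps(2)) (simp add: b_def del: power_coeff.simps)
    ultimately have "(power_coeff R a y (Suc j) 1 \<otimes> a \<oplus> b \<otimes> y) \<otimes> b = \<zero>"
      by (metis bc l_null)
    moreover have "a \<otimes> b = \<zero>"
      using k a(1) unfolding b_def j by (metis ac nat_pow_Suc2)
    ultimately show ?thesis
      by (simp add: l_distr m_assoc del: power_coeff.simps)
  qed
  ultimately show ?thesis using that by blast
qed

text \<open>The ideal product consists of sums of products of elements, so elementwise vanishing is
  enough to invoke primeness.\<close>

lemma trace_prime_elementwise:
  assumes "trace_prime R t" "trace_ideal I R t" "trace_ideal J R t"
    and zero: "\<And>x y. \<lbrakk>x \<in> I; y \<in> J\<rbrakk> \<Longrightarrow> x \<otimes> y = \<zero>"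
  shows "I = {\<zero>} \<or> J = {\<zero>}"
proof -
  have ideals: "ideal I R" "ideal J R" using assms(2,3) by (auto simp: trace_ideal_def)
  have "x = \<zero>" if "x \<in> ideal_prod R I J" for x
    using that by (induction rule: ideal_prod.induct) (simp_all add: zero)
  moreover have "\<zero> \<in> ideal_prod R I J"
    using additive_subgroup.zero_closed[OF ideal.axioms(1)[OF ideal_prod_is_ideal[OF ideals]]] .
  ultimately have "ideal_prod R I J = {\<zero>}" by blast
  then show ?thesis using assms(1-3) by (simp add: trace_prime_def)
qed

text \<open>All ideals inside an ideal with zero trace are trace ideals, so annihilators inside such an
  ideal can be fed to primeness.\<close>

lemma nil_trace_null_ideal_zero:
  assumes prime: "trace_prime R t" and tf: "torsion_free R" and J: "ideal J R"
    and null: "\<And>x. x \<in> J \<Longrightarrow> t x = \<zero>"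
    and nil: "\<And>x. x \<in> J \<Longrightarrow> x [^] (n :: nat) = \<zero>"
  shows "J = {\<zero>}"
proof (rule ccontr)
  assume nz: "J \<noteq> {\<zero>}"
  interpret J: ideal J R by fact
  obtain b where b: "b \<in> J" "b \<noteq> \<zero>" and sandwich: "\<And>y. y \<in> J \<Longrightarrow> b \<otimes> y \<otimes> b = \<zero>"
    using nil_bounded_index_sandwich[OF tf J nz nil] by blast
  have bc [simp]: "b \<in> carrier R" using b J.Icarr by blast
  have sub: "trace_ideal S R t" if "ideal S R" "S \<subseteq> J" for S
  proof -
    have "\<zero> \<in> S" by (rule additive_subgroup.zero_closed[OF ideal.axioms(1)[OF that(1)]])
    moreover have "t x = \<zero>" if "x \<in> S" for x using null[of x] that \<open>S \<subseteq> J\<close> by blast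
    ultimately show ?thesis unfolding trace_ideal_def using that(1) by (simp add: image_subset_iff)
  qed
  \<comment> \<open>The part of \<open>J\<close> annihilated by \<open>b R\<close> from the left.
    Letting \<open>r\<close> run through all of \<open>R\<close> makes this right annihilator stable
    under left multiplication too.\<close>
  define S where "S = {x \<in> J. \<forall>r\<in>carrier R. b \<otimes> r \<otimes> x = \<zero>}"
  have S: "ideal S R"
  proof (rule ideal_by_closure)
    fix r x assume r: "r \<in> carrier R" and x: "x \<in> S"
    then have xc: "x \<in> J" "x \<in> carrier R" using J.Icarr by (auto simp: S_def)
    have "b \<otimes> s \<otimes> (r \<otimes> x) = b \<otimes> (s \<otimes> r) \<otimes> x" if "s \<in> carrier R" for s
      using that r xc by (simp add: m_assoc)
    then show "r \<otimes> x \<in> S" using x r by (simp add: S_def J.I_l_closed)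
    have "b \<otimes> s \<otimes> (x \<otimes> r) = (b \<otimes> s \<otimes> x) \<otimes> r" if "s \<in> carrier R" for s
      using that r xc by (simp add: m_assoc)
    then show "x \<otimes> r \<in> S" using x r by (simp add: S_def J.I_r_closed)
  qed (use J.Icarr J.zero_closed J.a_closed in \<open>auto simp: S_def r_distr\<close>)
  \<comment> \<open>\<open>S' S = 0\<close>, and \<open>r = \<one>\<close> in the condition on
    \<open>S\<close> shows \<open>b \<in> S'\<close>. As \<open>b\<close> is nonzero, primeness
    leaves \<open>S = {\<zero>}\<close>.\<close>
  define S' where "S' = {y \<in> J. \<forall>x\<in>S. y \<otimes> x = \<zero>}"
  have SC: "x \<in> carrier R" "x \<in> J" if "x \<in> S" for x using that J.Icarr by (auto simp: S_def)
  have S': "ideal S' R"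
  proof (rule ideal_by_closure)
    fix r y assume r: "r \<in> carrier R" and y: "y \<in> S'"
    then have yc: "y \<in> J" "y \<in> carrier R" using J.Icarr by (auto simp: S'_def)
    have "r \<otimes> y \<otimes> x = r \<otimes> (y \<otimes> x)" "y \<otimes> r \<otimes> x = y \<otimes> (r \<otimes> x)" if "x \<in> S" for x
      using that r yc SC by (simp_all add: m_assoc)
    then show "r \<otimes> y \<in> S'" "y \<otimes> r \<in> S'"
      using y r ideal.I_l_closed[OF S _ r] by (simp_all add: S'_def J.I_l_closed J.I_r_closed)
  qed (use SC J.Icarr J.zero_closed J.a_closed in \<open>auto simp: S'_def l_distr\<close>)
  have "S' = {\<zero>} \<or> S = {\<zero>}"
    by (rule trace_prime_elementwise[OF prime sub[OF S'] sub[OF S]])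
      (simp_all add: S'_def SC(2) subsetI)
  moreover have "b \<otimes> x = \<zero>" if "x \<in> S" for x
  proof -
    have "b \<otimes> \<one> \<otimes> x = \<zero>" using that one_closed unfolding S_def by blast
    then show ?thesis by simp
  qed
  then have "b \<in> S'" using b unfolding S'_def by blast
  ultimately have S0: "S = {\<zero>}" using b by blast
  \<comment> \<open>The sandwich identity for \<open>r \<otimes> y\<close> in place of
    \<open>y\<close> puts \<open>J b\<close> into \<open>S\<close>, which is zero.\<close>
  have "y \<otimes> b \<in> S" if y: "y \<in> J" for y
  proof -
    have "b \<otimes> r \<otimes> (y \<otimes> b) = \<zero>" if "r \<in> carrier R" for r
      using sandwich[OF J.I_l_closed[OF y that]] that J.Icarr[OF y] by (simp add: m_assoc)
    then show ?thesis using J.I_l_closed[OF b(1) J.Icarr[OF y]] by (simp add: S_def)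
  qed
  then have Jb: "y \<otimes> b = \<zero>" if "y \<in> J" for y using that S0 by blast
  \<comment> \<open>The right annihilator of \<open>J\<close> in \<open>J\<close> now contains
    \<open>b\<close>, and \<open>J Z = 0\<close> contradicts primeness since both factors are
    nonzero.\<close>
  define Z where "Z = {x \<in> J. \<forall>y\<in>J. y \<otimes> x = \<zero>}"
  have Z: "ideal Z R"
  proof (rule ideal_by_closure)
    fix r x assume r: "r \<in> carrier R" and x: "x \<in> Z"
    then have xc: "x \<in> J" "x \<in> carrier R" using J.Icarr by (auto simp: Z_def)
    have "y \<otimes> (r \<otimes> x) = (y \<otimes> r) \<otimes> x" "y \<otimes> (x \<otimes> r) = (y \<otimes> x) \<otimes> r" if "y \<in> J" for y
      using that r xc J.Icarr by (simp_all add: m_assoc)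
    then show "r \<otimes> x \<in> Z" "x \<otimes> r \<in> Z"
      using x r J.I_r_closed[OF _ r] by (simp_all add: Z_def J.I_l_closed J.I_r_closed)
  qed (use J.Icarr J.zero_closed J.a_closed in \<open>auto simp: Z_def r_distr\<close>)
  have "J = {\<zero>} \<or> Z = {\<zero>}"
    by (rule trace_prime_elementwise[OF prime sub[OF J] sub[OF Z]]) (simp_all add: Z_def subset_iff)
  moreover have "b \<in> Z" using b Jb by (simp add: Z_def)
  ultimately show False using nz b by blast
qed

end

section \<open>Central localization of a prime ring with trace\<close>

text \<open>From the Cayley--Hamilton property in characteristic zero, localization and simplicity
  use three consequences: the unit is a trace, there is no torsion, and vanishing traces of all
  positive powers force nilpotency. The ground field and the polynomial return in
  \<open>prime_CH_algebra\<close>.\<close>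

locale prime_trace_ring = R?: ring R
  for R :: "('k, 'a, 'm) module_scheme" (structure) +
  fixes t :: "'a \<Rightarrow> 'a" and n :: nat
  assumes trace_closed [simp]: "x \<in> carrier R \<Longrightarrow> t x \<in> carrier R"
    and trace_add: "\<lbrakk>x \<in> carrier R; y \<in> carrier R\<rbrakk> \<Longrightarrow> t (x \<oplus> y) = t x \<oplus> t y"
    and trace_central: "\<lbrakk>a \<in> carrier R; b \<in> carrier R\<rbrakk> \<Longrightarrow> t a \<otimes> b = b \<otimes> t a"
    and trace_commute: "\<lbrakk>a \<in> carrier R; b \<in> carrier R\<rbrakk> \<Longrightarrow> t (a \<otimes> b) = t (b \<otimes> a)"
    and trace_trace_mult: "\<lbrakk>a \<in> carrier R; b \<in> carrier R\<rbrakk> \<Longrightarrow> t (t a \<otimes> b) = t a \<otimes> t b"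
    and one_in_trace: "\<one> \<in> t ` carrier R"
    and tf: "torsion_free R"
    and prime: "trace_prime R t"
    and nilpotent_of_null_traces:
      "\<lbrakk>x \<in> carrier R; \<And>j. 0 < j \<Longrightarrow> t (x [^] (j :: nat)) = \<zero>\<rbrakk> \<Longrightarrow> x [^] n = \<zero>"
begin

abbreviation A where "A \<equiv> trace_ring R t"
abbreviation G where "G \<equiv> fraction_field A"
abbreviation \<iota> where "\<iota> \<equiv> fraction_embedding A"

lemma trace_ring_simps [simp]:
  "carrier A = t ` carrier R" "monoid.mult A = monoid.mult R" "one A = one R"
  "ring.zero A = ring.zero R" "ring.add A = ring.add R"
  by (simp_all add: trace_ring_def)

lemma trace_zero [simp]: "t \<zero> = \<zero>"
  using trace_add[of \<zero> \<zero>] R.add.l_cancel_one by simp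

lemma trace_minus: "x \<in> carrier R \<Longrightarrow> t (\<ominus> x) = \<ominus> t x"
  using trace_add[of "\<ominus> x" x] R.minus_equality by (simp add: R.l_neg)

text \<open>Closure under products is the axiom \<open>t(t(x) y) = t(x) t(y)\<close> read from right
  to left.\<close>

lemma subring_trace: "subring (t ` carrier R) R"
proof (rule R.subringI)
  show "\<one> \<in> t ` carrier R" by (rule one_in_trace)
  show "\<ominus> h \<in> t ` carrier R" if "h \<in> t ` carrier R" for h
    using that trace_minus by (metis (no_types, lifting) R.a_inv_closed image_iff)
  fix h k assume "h \<in> t ` carrier R" "k \<in> t ` carrier R"
  then obtain x y where "x \<in> carrier R" "y \<in> carrier R" "h = t x" "k = t y" by blast
  then have "h \<otimes> k = t (t x \<otimes> y)" "h \<oplus> k = t (x \<oplus> y)" "t x \<otimes> y \<in> carrier R" "x \<oplus> y \<in> carrier R"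
    by (simp_all add: trace_trace_mult trace_add)
  then show "h \<otimes> k \<in> t ` carrier R" "h \<oplus> k \<in> t ` carrier R" by blast+
qed auto

lemma A_closed: "a \<in> t ` carrier R \<Longrightarrow> a \<in> carrier R"
  by auto

lemma A_central: "\<lbrakk>a \<in> t ` carrier R; r \<in> carrier R\<rbrakk> \<Longrightarrow> a \<otimes> r = r \<otimes> a"
  using trace_central by auto

lemma trace_A_mult:
  assumes "a \<in> t ` carrier R" "r \<in> carrier R"
  shows "t (r \<otimes> a) = t r \<otimes> a"
  using assms trace_trace_mult A_central by auto

lemma trace_torsion_free:
  assumes a: "a \<in> t ` carrier R" "a \<noteq> \<zero>" and r: "r \<in> carrier R" "r \<otimes> a = \<zero>"
  shows "r = \<zero>"
proof -
  let ?I = "{x \<otimes> a | x. x \<in> carrier R}" and ?J = "{x \<in> carrier R. x \<otimes> a = \<zero>}"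
  have ac [simp]: "a \<in> carrier R" using a by auto
  have sw: "x \<otimes> y \<otimes> a = x \<otimes> a \<otimes> y" if "x \<in> carrier R" "y \<in> carrier R" for x y
    using that A_central[OF a(1), of y] by (simp add: R.m_assoc)
  have "ideal ?I R"
  proof (rule R.ideal_by_closure)
    show "\<zero> \<in> ?I" by (rule CollectI, rule exI[of _ \<zero>]) simp
    fix x y assume "x \<in> ?I" "y \<in> ?I"
    then obtain x' y' where "x' \<in> carrier R" "y' \<in> carrier R" "x = x' \<otimes> a" "y = y' \<otimes> a" by blast
    then have "x \<oplus> y = (x' \<oplus> y') \<otimes> a" "x' \<oplus> y' \<in> carrier R" by (simp_all add: R.l_distr)
    then show "x \<oplus> y \<in> ?I" by blast
  next
    fix s x assume s: "s \<in> carrier R" and "x \<in> ?I"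
    then obtain x' where x': "x' \<in> carrier R" "x = x' \<otimes> a" by blast
    then have "s \<otimes> x = (s \<otimes> x') \<otimes> a" "x \<otimes> s = (x' \<otimes> s) \<otimes> a"
      using s sw by (simp_all add: R.m_assoc)
    then show "s \<otimes> x \<in> ?I" "x \<otimes> s \<in> ?I" using s x' R.m_closed by blast+
  qed auto
  moreover have "t (x \<otimes> a) = t x \<otimes> a" "t x \<in> carrier R" if "x \<in> carrier R" for x
    using that trace_A_mult[OF a(1)] by simp_all
  ultimately have I: "trace_ideal ?I R t"
    unfolding trace_ideal_def image_subset_iff by blast
  have "ideal ?J R"
  proof (rule R.ideal_by_closure)
    fix s x assume "s \<in> carrier R" "x \<in> ?J"
    then show "s \<otimes> x \<in> ?J" "x \<otimes> s \<in> ?J"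
      using sw[of x s] by (simp_all add: R.m_assoc[of s x a])
  qed (auto simp: R.l_distr)
  moreover have "t x \<in> ?J" if "x \<in> ?J" for x
    using that trace_A_mult[OF a(1), of x] by force
  ultimately have J: "trace_ideal ?J R t"
    unfolding trace_ideal_def by (intro conjI image_subsetI)
  have "x \<otimes> y = \<zero>" if xy: "x \<in> ?I" "y \<in> ?J" for x y
  proof -
    obtain x' where x': "x' \<in> carrier R" "x = x' \<otimes> a" using xy(1) by blast
    have y: "y \<in> carrier R" "y \<otimes> a = \<zero>" using xy(2) by blast+
    have "a \<otimes> y = \<zero>" using A_central[OF a(1) y(1)] y(2) by (rule trans)
    then show ?thesis using x' y(1) by (simp only: R.m_assoc ac R.r_null)
  qed
  then have "?I = {\<zero>} \<or> ?J = {\<zero>}"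
    by (rule R.trace_prime_elementwise[OF prime I J])
  moreover have "a \<in> ?I" by (rule CollectI, rule exI[of _ \<one>]) simp
  ultimately have "?J = {\<zero>}" using a by blast
  then show ?thesis using r by blast
qed

lemma domain_trace_ring: "domain A"
proof -
  have "subdomain (t ` carrier R) R"
  proof (rule R.subdomainI[OF R.subcringI[OF subring_trace]])
    show "\<one> \<noteq> \<zero>"
      using prime R.one_zeroD by (auto simp: trace_prime_def)
    fix h k assume hk: "h \<in> t ` carrier R" "k \<in> t ` carrier R"
    then show "h \<otimes> k = k \<otimes> h" by (simp add: A_central A_closed)
    show "h = \<zero> \<or> k = \<zero>" if "h \<otimes> k = \<zero>"
      using that trace_torsion_free[of k h] hk A_closed by blast
  qed
  then show ?thesis unfolding trace_ring_def by (rule R.subdomain_is_domain)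
qed

sublocale A: domain A
  by (rule domain_trace_ring)

sublocale scalar_extension R G A \<iota>
proof (intro scalar_extension.intro scalar_extension_axioms.intro)
  show "ring R" by (rule R.ring_axioms)
  show "cring G" by (rule A.cring_fraction_field)
  show "carrier A \<subseteq> carrier R" by auto
  show "\<And>a r. \<lbrakk>a \<in> carrier A; r \<in> carrier R\<rbrakk> \<Longrightarrow> a \<otimes> r = r \<otimes> a" by (rule A_central) simp_all
  show "\<And>a. a \<in> carrier A \<Longrightarrow> \<iota> a \<in> carrier G"
    using A.fraction_closed A.one_nonzero by (simp add: fraction_embedding_def)
qed

section \<open>Clearing denominators and injectivity of the natural map\<close>

abbreviation A' where "A' \<equiv> carrier A - {\<zero>\<^bsub>A\<^esub>}"
abbreviation unit_fraction where "unit_fraction d \<equiv> fraction A \<one>\<^bsub>A\<^esub> d"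

lemma embedding_closed [simp]: "a \<in> carrier A \<Longrightarrow> \<iota> a \<in> carrier G"
  by (rule structure_map_closed)

lemma embedding_mult: "\<lbrakk>a \<in> carrier A; b \<in> carrier A\<rbrakk> \<Longrightarrow> \<iota> (a \<otimes> b) = \<iota> a \<otimes>\<^bsub>G\<^esub> \<iota> b"
  using ring_hom_mult[OF A.fraction_embedding_hom] by simp

lemma embedding_add: "\<lbrakk>a \<in> carrier A; b \<in> carrier A\<rbrakk> \<Longrightarrow> \<iota> (a \<oplus> b) = \<iota> a \<oplus>\<^bsub>G\<^esub> \<iota> b"
  using ring_hom_add[OF A.fraction_embedding_hom] by simp

lemma embedding_inj: "\<lbrakk>\<iota> a = \<iota> b; a \<in> carrier A; b \<in> carrier A\<rbrakk> \<Longrightarrow> a = b"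
  using A.inj_fraction_embedding by (rule inj_onD)

text \<open>The element of \<open>A\<close> that equals \<open>d u\<close> when \<open>d\<close>
  clears the denominator of \<open>u\<close>. The default zero makes it total, so that it defines a
  homomorphism on the whole free abelian group.\<close>

definition numerator where
  "numerator d u = (if \<exists>a\<in>carrier A. \<iota> d \<otimes>\<^bsub>G\<^esub> u = \<iota> a
    then SOME a. a \<in> carrier A \<and> \<iota> d \<otimes>\<^bsub>G\<^esub> u = \<iota> a else \<zero>)"

lemma numerator_eq:
  assumes "a \<in> carrier A" "\<iota> d \<otimes>\<^bsub>G\<^esub> u = \<iota> a"
  shows "numerator d u = a"
proof -
  have "(SOME a. a \<in> carrier A \<and> \<iota> d \<otimes>\<^bsub>G\<^esub> u = \<iota> a) = a"
    by (rule some_equality) (use assms embedding_inj in auto)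
  then show ?thesis using assms unfolding numerator_def by auto
qed

lemma numerator_closed: "numerator d u \<in> carrier A"
proof (cases "\<exists>a\<in>carrier A. \<iota> d \<otimes>\<^bsub>G\<^esub> u = \<iota> a")
  case True
  then show ?thesis using numerator_eq by metis
next
  case False
  then show ?thesis using A.zero_closed unfolding numerator_def by simp
qed

text \<open>Once \<open>d\<close> clears \<open>u\<close>, so does every multiple of
  \<open>d\<close>, and the numerator scales accordingly. Hence finitely many denominators can be
  cleared at once by their product.\<close>

lemma numerator_multiple:
  assumes "a \<in> carrier A" "d \<in> carrier A" "e \<in> carrier A" "u \<in> carrier G"
    "\<iota> d \<otimes>\<^bsub>G\<^esub> u = \<iota> a"
  shows "numerator (d \<otimes> e) u = a \<otimes> e"
proof (rule numerator_eq)
  show ae: "a \<otimes> e \<in> carrier A" using A.m_closed assms(1,3) by simp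
  have "\<iota> (d \<otimes> e) \<otimes>\<^bsub>G\<^esub> u = \<iota> d \<otimes>\<^bsub>G\<^esub> u \<otimes>\<^bsub>G\<^esub> \<iota> e"
    using assms(1-4) by (simp only: embedding_mult embedding_closed U.m_ac U.m_closed)
  then show "\<iota> (d \<otimes> e) \<otimes>\<^bsub>G\<^esub> u = \<iota> (a \<otimes> e)"
    using assms by (simp only: embedding_mult)
qed

text \<open>Clearing denominators by \<open>d\<close> is additive only on the tensors whose second factors lie in
  \<open>(1/d) A\<close>; the relations are killed by all multiples of a suitable \<open>d\<close>.\<close>

lemma pure_one_inj:
  assumes r: "r \<in> carrier R" and s: "s \<in> carrier R"
    and eq: "pure r \<one>\<^bsub>G\<^esub> = pure s \<one>\<^bsub>G\<^esub>"
  shows "r = s"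
proof -
  have nc [simp]: "numerator d u \<in> carrier R" for d u
    using numerator_closed A_closed by simp
  \<comment> \<open>The map "multiply by \<open>d\<close>, then evaluate in \<open>R\<close>", from
    the universal property of the free abelian group. It respects the relations only when
    \<open>d\<close> clears the second factors involved.\<close>
  have "\<exists>h. h \<in> hom (free_Abelian_group (carrier R \<times> carrier G)) (add_monoid R) \<and>
      (\<forall>x\<in>carrier R \<times> carrier G. h (frag_of x) = fst x \<otimes> numerator d (snd x))" for d
    by (rule comm_group.free_Abelian_group_universal[OF R.a_comm_group,
        of "\<lambda>x. fst x \<otimes> numerator d (snd x)" "carrier R \<times> carrier G"]) auto
  then obtain h where hom: "\<And>d. h d \<in> hom (free_Abelian_group (carrier R \<times> carrier G)) (add_monoid R)"
    and h: "\<And>d x. x \<in> carrier R \<times> carrier G \<Longrightarrow> h d (frag_of x) = fst x \<otimes> numerator d (snd x)"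
    by metis
  have h_of: "h d (frag_of (r, u)) = r \<otimes> numerator d u" if "r \<in> carrier R" "u \<in> carrier G" for d r u
    using h[of "(r, u)"] that by simp
  have hc: "h d p \<in> carrier R" if "p \<in> carrier P" for d p
    using hom_in_carrier[OF hom, of p] that by simp
  have h_add: "h d (p + q) = h d p \<oplus> h d q" if "p \<in> carrier P" "q \<in> carrier P" for d p q
    using hom_mult[OF hom, of p q] that by simp
  have h_diff: "h d (p - q) = h d p \<ominus> h d q" if "p \<in> carrier P" "q \<in> carrier P" for d p q
  proof -
    have "h d p = h d (p - q) \<oplus> h d q"
      using h_add[OF pair_diff_closed[OF that] that(2)] by simp
    then show ?thesis
      using hc[OF pair_diff_closed[OF that]] hc[OF that(2)]
      by (simp add: R.minus_eq R.a_assoc R.r_neg)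
  qed
  have cancel: "x \<oplus> y \<ominus> x \<ominus> y = \<zero>" if "x \<in> carrier R" "y \<in> carrier R" for x y
    using R.r_neg[of "x \<oplus> y"] that by (simp add: R.minus_eq R.minus_add R.a_ac)
  have "frag_of (r, \<one>\<^bsub>G\<^esub>) - frag_of (s, \<one>\<^bsub>G\<^esub>) \<in> N"
    using eq by (simp add: pure_eq_cls cls_eq_iff)
  \<comment> \<open>Quantifying over all multiples \<open>d \<otimes> e\<close> makes the claim
    stable under differences: if \<open>d\<close> works for \<open>p\<close> and \<open>c\<close>
    for \<open>q\<close>, then \<open>d \<otimes> c\<close> works for \<open>p - q\<close>.\<close>
  then have "\<exists>d\<in>A'. \<forall>e\<in>A'. h (d \<otimes> e) (frag_of (r, \<one>\<^bsub>G\<^esub>) - frag_of (s, \<one>\<^bsub>G\<^esub>)) = \<zero>"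
  proof (induction rule: relations_induct)
    case (left r s u)
    have "h d (frag_of (r \<oplus> s, u) - frag_of (r, u) - frag_of (s, u)) = \<zero>" for d
      using left
      by (simp add: h_diff pair_diff_closed pair_of_closed h_of R.l_distr cancel
          del: pair_ring_simps(1))
    then show ?case using A.one_nonzero by blast
  next
    case (right r u v)
    obtain a d where a: "a \<in> carrier A" "d \<in> A'" "\<iota> d \<otimes>\<^bsub>G\<^esub> u = \<iota> a"
      using right(2) by (rule A.fraction_embedding_clear)
    obtain b c where b: "b \<in> carrier A" "c \<in> A'" "\<iota> c \<otimes>\<^bsub>G\<^esub> v = \<iota> b"
      using right(3) by (rule A.fraction_embedding_clear)
    have "h (d \<otimes> c \<otimes> e) (frag_of (r, u \<oplus>\<^bsub>G\<^esub> v) - frag_of (r, u) - frag_of (r, v)) = \<zero>"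
      if e: "e \<in> A'" for e
    proof -
      have cl: "d \<in> carrier A" "c \<in> carrier A" "e \<in> carrier A"
        using a(2) b(2) e by (simp_all only: Diff_iff)
      have dc: "d \<otimes> c \<in> carrier A" and ac: "a \<otimes> c \<in> carrier A" and bd: "b \<otimes> d \<in> carrier A"
        using A.m_closed[OF cl(1,2)] A.m_closed[OF a(1) cl(2)] A.m_closed[OF b(1) cl(1)]
        by (simp_all only: trace_ring_simps)
      have sum: "a \<otimes> c \<oplus> b \<otimes> d \<in> carrier A"
        using A.add.m_closed[OF ac bd] by (simp only: trace_ring_simps)
      have "\<iota> (d \<otimes> c) \<otimes>\<^bsub>G\<^esub> u = \<iota> d \<otimes>\<^bsub>G\<^esub> u \<otimes>\<^bsub>G\<^esub> \<iota> c"
        using right(2) cl by (simp only: embedding_mult embedding_closed U.m_ac U.m_closed)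
      then have u: "\<iota> (d \<otimes> c) \<otimes>\<^bsub>G\<^esub> u = \<iota> (a \<otimes> c)"
        by (simp only: a(1,3) cl embedding_mult)
      have "\<iota> (d \<otimes> c) \<otimes>\<^bsub>G\<^esub> v = \<iota> c \<otimes>\<^bsub>G\<^esub> v \<otimes>\<^bsub>G\<^esub> \<iota> d"
        using right(3) cl by (simp only: embedding_mult embedding_closed U.m_ac U.m_closed)
      then have v: "\<iota> (d \<otimes> c) \<otimes>\<^bsub>G\<^esub> v = \<iota> (b \<otimes> d)"
        by (simp only: b(1,3) cl embedding_mult)
      have uv: "\<iota> (d \<otimes> c) \<otimes>\<^bsub>G\<^esub> (u \<oplus>\<^bsub>G\<^esub> v) = \<iota> (a \<otimes> c \<oplus> b \<otimes> d)"
        using right cl by (simp only: embedding_add[OF ac bd] embedding_closed[OF dc] U.r_distr u v)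
      note num = numerator_multiple[OF ac dc cl(3) right(2) u]
        numerator_multiple[OF bd dc cl(3) right(3) v]
        numerator_multiple[OF sum dc cl(3) U.add.m_closed[OF right(2,3)] uv]
      have rc: "a \<otimes> c \<in> carrier R" "b \<otimes> d \<in> carrier R" "e \<in> carrier R"
        using ac bd cl(3) A_closed by (simp_all only: trace_ring_simps)
      show ?thesis
        using right rc
        by (simp add: h_diff pair_diff_closed pair_of_closed h_of num R.l_distr R.r_distr cancel
            del: pair_ring_simps(1))
    qed
    moreover have "d \<otimes> c \<in> A'" using A.mult_nonzero[OF a(2) b(2)] by simp
    ultimately show ?case by blast
  next
    case (balanced r a u)
    obtain b d where b: "b \<in> carrier A" "d \<in> A'" "\<iota> d \<otimes>\<^bsub>G\<^esub> u = \<iota> b"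
      using balanced(3) by (rule A.fraction_embedding_clear)
    have "h (d \<otimes> e) (frag_of (r \<otimes> a, u) - frag_of (r, \<iota> a \<otimes>\<^bsub>G\<^esub> u)) = \<zero>" if e: "e \<in> A'" for e
    proof -
      have cl: "d \<in> carrier A" "e \<in> carrier A"
        using b(2) e by (simp_all only: Diff_iff)
      have ab: "a \<otimes> b \<in> carrier A"
        using A.m_closed[OF balanced(2) b(1)] by (simp only: trace_ring_simps)
      have "\<iota> d \<otimes>\<^bsub>G\<^esub> (\<iota> a \<otimes>\<^bsub>G\<^esub> u) = \<iota> a \<otimes>\<^bsub>G\<^esub> (\<iota> d \<otimes>\<^bsub>G\<^esub> u)"
        by (rule U.m_lcomm[OF embedding_closed[OF cl(1)] embedding_closed[OF balanced(2)] balanced(3)])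
      then have u: "\<iota> d \<otimes>\<^bsub>G\<^esub> (\<iota> a \<otimes>\<^bsub>G\<^esub> u) = \<iota> (a \<otimes> b)"
        by (simp only: b(3) embedding_mult[OF balanced(2) b(1)])
      note num = numerator_multiple[OF b(1) cl balanced(3) b(3)]
        numerator_multiple[OF ab cl U.m_closed[OF embedding_closed[OF balanced(2)] balanced(3)] u]
      have rc: "a \<in> carrier R" "b \<in> carrier R" "e \<in> carrier R"
        using cl b(1) balanced(2) A_closed by (simp_all only: trace_ring_simps)
      show ?thesis
        using balanced rc
        by (simp add: h_diff pair_of_closed h_of num R.m_assoc R.minus_eq R.r_neg embedding_closed
            del: pair_ring_simps(1) trace_ring_simps(1))
    qed
    then show ?case using b by blast
  next
    case zero
    have "h d 0 = \<zero>" for d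
      using h_diff[of 0 0 d] hc[of 0 d] by (simp add: R.minus_eq R.r_neg)
    then show ?case using A.one_nonzero by blast
  next
    case (diff p q)
    then obtain d c where d: "d \<in> A'" "\<And>e. e \<in> A' \<Longrightarrow> h (d \<otimes> e) p = \<zero>"
      and c: "c \<in> A'" "\<And>e. e \<in> A' \<Longrightarrow> h (c \<otimes> e) q = \<zero>" by blast
    have "h (d \<otimes> c \<otimes> e) (p - q) = \<zero>" if e: "e \<in> A'" for e
    proof -
      have "d \<otimes> c \<otimes> e = d \<otimes> (c \<otimes> e)" "d \<otimes> c \<otimes> e = c \<otimes> (d \<otimes> e)"
        using A.m_assoc[of d c e] A.m_lcomm[of d c e] d c e by simp_all
      moreover have "c \<otimes> e \<in> A'" "d \<otimes> e \<in> A'"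
        using A.mult_nonzero[OF c(1) e] A.mult_nonzero[OF d(1) e] by simp_all
      ultimately have "h (d \<otimes> c \<otimes> e) p = \<zero>" "h (d \<otimes> c \<otimes> e) q = \<zero>"
        using d(2) c(2) by metis+
      then show ?thesis using h_diff[OF diff(1,2)] by (simp add: R.minus_eq)
    qed
    moreover have "d \<otimes> c \<in> A'" using A.mult_nonzero[OF d(1) c(1)] by simp
    ultimately show ?case by blast
  qed
  \<comment> \<open>The multiple with \<open>e = \<one>\<close> suffices: the numerator of
    \<open>\<one>\<close> with respect to \<open>d\<close> is \<open>d\<close>, so
    \<open>(r - s) d = 0\<close>, and torsion-freeness finishes.\<close>
  then obtain d where d: "d \<in> A'"
    and zero: "h (d \<otimes> \<one>) (frag_of (r, \<one>\<^bsub>G\<^esub>) - frag_of (s, \<one>\<^bsub>G\<^esub>)) = \<zero>"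
    using A.one_nonzero by auto
  have dc: "d \<in> carrier R" using d A_closed by simp
  have "numerator d \<one>\<^bsub>G\<^esub> = d"
    using numerator_eq[of d d "\<one>\<^bsub>G\<^esub>"] d U.r_one[OF embedding_closed[of d]] by simp
  then have "r \<otimes> d \<ominus> s \<otimes> d = \<zero>"
    using zero r s dc by (simp add: h_diff pair_of_closed h_of del: pair_ring_simps(1))
  then have "(r \<ominus> s) \<otimes> d = \<zero>"
    using r s dc by (simp add: R.minus_eq R.l_distr R.l_minus)
  then have "r \<ominus> s = \<zero>"
    using trace_torsion_free[of d "r \<ominus> s"] d r s by simp
  then show ?thesis using r s R.r_right_minus_eq by blast
qed

end

section \<open>Tensors with a single denominator, and trace simplicity\<close>

context prime_trace_ring
begin

abbreviation tG where "tG \<equiv> tensor_trace A R G \<iota> t"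

lemma unit_fraction_closed [simp]: "d \<in> A' \<Longrightarrow> unit_fraction d \<in> carrier G"
  using A.fraction_closed[OF A.one_closed] by simp

lemma A'_closed: "d \<in> A' \<Longrightarrow> d \<in> carrier A"
  by (simp only: Diff_iff)

lemma A'_mult: "\<lbrakk>d \<in> A'; e \<in> A'\<rbrakk> \<Longrightarrow> d \<otimes> e \<in> A'"
  using A.mult_nonzero by simp

lemma embedding_unit_fraction:
  "\<lbrakk>a \<in> carrier A; d \<in> A'\<rbrakk> \<Longrightarrow> \<iota> a \<otimes>\<^bsub>G\<^esub> unit_fraction d = fraction A a d"
  using A.fraction_mult[of a "\<one>" "\<one>" d] A.one_nonzero A.r_one[of a] A.l_one[of d]
  by (simp add: fraction_embedding_def)

lemma embedding_unit_fraction_self: "d \<in> A' \<Longrightarrow> \<iota> d \<otimes>\<^bsub>G\<^esub> unit_fraction d = \<one>\<^bsub>G\<^esub>"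
  using embedding_unit_fraction[of d d] A.fraction_eq_iff[of d d "\<one>" "\<one>"] A.one_nonzero
    A.r_one[of d] A.l_one[of d] A.fraction_field_one by simp

lemma embedding_unit_fraction_cancel:
  assumes d: "d \<in> A'" and e: "e \<in> A'"
  shows "\<iota> e \<otimes>\<^bsub>G\<^esub> unit_fraction (d \<otimes> e) = unit_fraction d"
proof -
  have "e \<otimes>\<^bsub>A\<^esub> d = \<one>\<^bsub>A\<^esub> \<otimes>\<^bsub>A\<^esub> (d \<otimes>\<^bsub>A\<^esub> e)"
    using A'_closed[OF d] A'_closed[OF e] A.m_comm[of e d] A.l_one[OF A.m_closed] by simp
  then have "fraction A e (d \<otimes> e) = unit_fraction d"
    using A.fraction_eq_iff[of e "d \<otimes> e" "\<one>" d] A'_mult[OF d e] A'_closed[OF e] d A.one_closed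
    by simp
  then show ?thesis
    using embedding_unit_fraction[OF A'_closed[OF e] A'_mult[OF d e]] by simp
qed

lemma pure_expand:
  assumes "r \<in> carrier R" "d \<in> A'" "e \<in> A'"
  shows "pure r (unit_fraction d) = pure (r \<otimes> e) (unit_fraction (d \<otimes> e))"
  unfolding pure_balanced[OF assms(1) A'_closed[OF assms(3)] unit_fraction_closed[OF A'_mult[OF assms(2,3)]]]
    embedding_unit_fraction_cancel[OF assms(2,3)] ..

text \<open>Pure tensors combine into a pure tensor when they share a factor; expanding both to the
  denominator \<open>d \<otimes> e\<close> provides it.\<close>

lemma common_denominator:
  assumes "r \<in> carrier R" "s \<in> carrier R" "d \<in> A'" "e \<in> A'"
  obtains r' s' c where "r' \<in> carrier R" "s' \<in> carrier R" "c \<in> A'"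
    "pure r (unit_fraction d) = pure r' (unit_fraction c)"
    "pure s (unit_fraction e) = pure s' (unit_fraction c)"
proof -
  have cl: "d \<in> carrier R" "e \<in> carrier R"
    using assms A'_closed A_closed by (simp_all only: trace_ring_simps)
  have de: "e \<otimes> d = d \<otimes> e"
    using A.m_comm[OF A'_closed[OF assms(4)] A'_closed[OF assms(3)]] by simp
  show ?thesis
  proof (rule that)
    show "r \<otimes> e \<in> carrier R" "s \<otimes> d \<in> carrier R" using assms cl by simp_all
    show "d \<otimes> e \<in> A'" using assms by (intro A'_mult)
    show "pure r (unit_fraction d) = pure (r \<otimes> e) (unit_fraction (d \<otimes> e))"
      using assms by (intro pure_expand)
    show "pure s (unit_fraction e) = pure (s \<otimes> d) (unit_fraction (d \<otimes> e))"
      using pure_expand[OF assms(2,4,3)] de by simp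
  qed
qed

lemma pure_diff:
  assumes "r \<in> carrier R" "s \<in> carrier R" "u \<in> carrier G"
  shows "pure r u \<ominus>\<^bsub>RU\<^esub> pure s u = pure (r \<ominus> s) u"
proof -
  interpret T: ring RU by (rule ring_tensor_algebra)
  show ?thesis using assms by (simp add: T.minus_eq pure_minus pure_add_left R.minus_eq)
qed

lemma tensor_cases:
  assumes "x \<in> carrier RU"
  obtains r d where "r \<in> carrier R" "d \<in> A'" "x = pure r (unit_fraction d)"
proof -
  from assms have "\<exists>r\<in>carrier R. \<exists>d\<in>A'. x = pure r (unit_fraction d)"
  proof (induction rule: tensor_induct)
    case (pure r u)
    obtain a d where a: "a \<in> carrier A" "d \<in> A'" "u = fraction A a d"
      using pure(2) by (rule A.fraction_cases)
    have "pure r u = pure (r \<otimes> a) (unit_fraction d)"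
      unfolding a(3) pure_balanced[OF pure(1) a(1) unit_fraction_closed[OF a(2)]]
        embedding_unit_fraction[OF a(1,2)] ..
    moreover have "r \<otimes> a \<in> carrier R"
      using pure a(1) A_closed by (simp only: trace_ring_simps R.m_closed)
    ultimately show ?case using a(2) by blast
  next
    case (diff x y)
    obtain r d where r: "r \<in> carrier R" "d \<in> A'" "x = pure r (unit_fraction d)" using diff by blast
    obtain s e where s: "s \<in> carrier R" "e \<in> A'" "y = pure s (unit_fraction e)" using diff by blast
    obtain r' s' c where c: "r' \<in> carrier R" "s' \<in> carrier R" "c \<in> A'"
      "pure r (unit_fraction d) = pure r' (unit_fraction c)"
      "pure s (unit_fraction e) = pure s' (unit_fraction c)"
      using common_denominator[OF r(1) s(1) r(2) s(2)] by blast
    have "x \<ominus>\<^bsub>RU\<^esub> y = pure (r' \<ominus> s') (unit_fraction c)"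
      unfolding r(3) s(3) c(4,5) using c(1-3) by (intro pure_diff unit_fraction_closed)
    then show ?case using c(1-3) R.minus_closed by blast
  qed
  then show ?thesis using that by blast
qed

lemma tensor_cases2:
  assumes "x \<in> carrier RU" "y \<in> carrier RU"
  obtains r s d where "r \<in> carrier R" "s \<in> carrier R" "d \<in> A'"
    "x = pure r (unit_fraction d)" "y = pure s (unit_fraction d)"
proof -
  obtain r d where r: "r \<in> carrier R" "d \<in> A'" "x = pure r (unit_fraction d)"
    using assms(1) by (rule tensor_cases)
  obtain s e where s: "s \<in> carrier R" "e \<in> A'" "y = pure s (unit_fraction e)"
    using assms(2) by (rule tensor_cases)
  show ?thesis
    using common_denominator[OF r(1) s(1) r(2) s(2)] r(3) s(3) that by metis
qed

lemma tensor_trace_pure: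
  assumes "r \<in> carrier R" "u \<in> carrier G"
  shows "tG (pure r u) = pure (t r) u"
  unfolding tensor_trace_def
proof (rule tensor_lift_pure)
  show "t (r \<otimes> a) = t r \<otimes> a" if "r \<in> carrier R" "a \<in> carrier A" for r a
    using that trace_A_mult by (simp only: trace_ring_simps)
qed (use assms trace_add in auto)

lemma pure_trace:
  assumes "a \<in> carrier A" "u \<in> carrier G"
  shows "pure a u = pure \<one> (\<iota> a \<otimes>\<^bsub>G\<^esub> u)"
  using pure_balanced[OF R.one_closed assms] assms(1) A_closed by (simp only: trace_ring_simps R.l_one)

text \<open>A trace \<open>t(r) \<otimes> 1/d\<close> moves its first factor across the tensor sign,
  since \<open>t(r)\<close> lies in \<open>A\<close>. Conversely, an \<open>e\<close> with
  \<open>t(e) = 1\<close> realizes \<open>1 \<otimes> u\<close> as the trace of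
  \<open>e \<otimes> u\<close>.\<close>

lemma tensor_trace_image: "tG ` carrier RU = pure \<one> ` carrier G"
proof (intro equalityI subsetI)
  fix y assume "y \<in> tG ` carrier RU"
  then obtain x where x: "x \<in> carrier RU" "y = tG x" by blast
  obtain r d where r: "r \<in> carrier R" "d \<in> A'" "x = pure r (unit_fraction d)"
    using x(1) by (rule tensor_cases)
  have tr: "t r \<in> carrier A" using r by simp
  have "y = pure \<one> (\<iota> (t r) \<otimes>\<^bsub>G\<^esub> unit_fraction d)"
    using x r tensor_trace_pure[OF r(1) unit_fraction_closed[OF r(2)]]
      pure_trace[OF tr unit_fraction_closed[OF r(2)]] by simp
  then show "y \<in> pure \<one> ` carrier G"
    using U.m_closed[OF embedding_closed[OF tr] unit_fraction_closed[OF r(2)]] by blast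
next
  fix y assume "y \<in> pure \<one> ` carrier G"
  then obtain u where u: "u \<in> carrier G" "y = pure \<one> u" by blast
  obtain e where e: "e \<in> carrier R" "t e = \<one>" using one_in_trace by (metis imageE)
  then have "y = tG (pure e u)" using u tensor_trace_pure by simp
  then show "y \<in> tG ` carrier RU" using e u pure_closed by blast
qed

text \<open>Multiplying by \<open>1 \<otimes> d\<close> removes the denominator and reduces the
  claim to \<open>pure_one_inj\<close>.\<close>

lemma pure_eq_zero_iff:
  assumes "r \<in> carrier R" "d \<in> A'"
  shows "pure r (unit_fraction d) = \<zero>\<^bsub>RU\<^esub> \<longleftrightarrow> r = \<zero>"
proof
  interpret T: ring RU by (rule ring_tensor_algebra)
  assume eq: "pure r (unit_fraction d) = \<zero>\<^bsub>RU\<^esub>"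
  have "pure r \<one>\<^bsub>G\<^esub> = pure r (unit_fraction d) \<otimes>\<^bsub>RU\<^esub> pure \<one> (\<iota> d)"
    using pure_mult[OF assms(1) unit_fraction_closed[OF assms(2)] R.one_closed
        embedding_closed[OF A'_closed[OF assms(2)]]]
      U.m_comm[OF unit_fraction_closed[OF assms(2)] embedding_closed[OF A'_closed[OF assms(2)]]]
      embedding_unit_fraction_self[OF assms(2)] assms(1) by (simp only: R.r_one)
  also have "\<dots> = \<zero>\<^bsub>RU\<^esub>"
    unfolding eq by (intro T.l_null pure_closed R.one_closed embedding_closed A'_closed assms(2))
  also have "\<dots> = pure \<zero> \<one>\<^bsub>G\<^esub>" by (rule pure_zero_left[symmetric]) (rule U.one_closed)
  finally show "r = \<zero>" using pure_one_inj assms(1) by blast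
next
  assume "r = \<zero>"
  then show "pure r (unit_fraction d) = \<zero>\<^bsub>RU\<^esub>"
    using pure_zero_left[OF unit_fraction_closed[OF assms(2)]] by simp
qed

lemma trace_simple_tensor: "trace_simple RU tG"
  unfolding trace_simple_def
proof (intro conjI allI impI)
  interpret T: ring RU by (rule ring_tensor_algebra)
  have "pure \<one> \<one>\<^bsub>G\<^esub> \<noteq> \<zero>\<^bsub>RU\<^esub>"
    using pure_one_inj[OF R.one_closed R.zero_closed] A.one_not_zero
      pure_zero_left[OF U.one_closed] by auto
  then show "carrier RU \<noteq> {\<zero>\<^bsub>RU\<^esub>}"
    using pure_closed[OF R.one_closed U.one_closed] by blast
  fix I assume I: "trace_ideal I RU tG"
  interpret I: ideal I RU using I by (simp only: trace_ideal_def)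
  have tI: "tG x \<in> I" if "x \<in> I" for x using I that unfolding trace_ideal_def by blast
  define J where "J = {r \<in> carrier R. pure r \<one>\<^bsub>G\<^esub> \<in> I}"
  have JC: "r \<in> carrier R" "pure r \<one>\<^bsub>G\<^esub> \<in> I" if "r \<in> J" for r using that unfolding J_def by blast+
  have J_I: "r \<in> J" if "r \<in> carrier R" "pure r \<one>\<^bsub>G\<^esub> \<in> I" for r using that unfolding J_def by blast
  have J: "ideal J R"
  proof (rule R.ideal_by_closure)
    show "J \<subseteq> carrier R" using JC by blast
    show "\<zero> \<in> J" using I.zero_closed pure_zero_left[OF U.one_closed] by (intro J_I) simp_all
    fix x y assume x: "x \<in> J"
    show "x \<oplus> y \<in> J" if "y \<in> J"
      using I.a_closed[OF JC(2)[OF x] JC(2)[OF that]] JC(1)[OF x] JC(1)[OF that]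
      by (intro J_I) (simp_all add: pure_add_left)
    assume y: "y \<in> carrier R"
    show "y \<otimes> x \<in> J"
      using I.I_l_closed[OF JC(2)[OF x] pure_closed[OF y U.one_closed]] JC(1)[OF x] y
      by (intro J_I) (simp_all add: pure_mult)
    show "x \<otimes> y \<in> J"
      using I.I_r_closed[OF JC(2)[OF x] pure_closed[OF y U.one_closed]] JC(1)[OF x] y
      by (intro J_I) (simp_all add: pure_mult)
  qed
  interpret J: ideal J R by (rule J)
  show "I = {\<zero>\<^bsub>RU\<^esub>} \<or> I = carrier RU"
  proof (cases "\<exists>j\<in>J. t j \<noteq> \<zero>")
    case True
    then obtain j where j: "j \<in> J" "t j \<noteq> \<zero>" by blast
    have jc: "j \<in> carrier R" using JC j by blast
    have a: "t j \<in> A'" using jc j by simp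
    \<comment> \<open>\<open>t j\<close> is a nonzero element of \<open>A\<close>, hence invertible
      in \<open>G\<close>; dividing by it puts the unit into \<open>I\<close>.\<close>
    have "pure (t j) \<one>\<^bsub>G\<^esub> \<in> I"
      using tI[OF JC(2)[OF j(1)]] tensor_trace_pure[OF jc U.one_closed] by simp
    then have "pure (t j) \<one>\<^bsub>G\<^esub> \<otimes>\<^bsub>RU\<^esub> pure \<one> (unit_fraction (t j)) \<in> I"
      by (rule I.I_r_closed) (intro pure_closed R.one_closed unit_fraction_closed a)
    also have "pure (t j) \<one>\<^bsub>G\<^esub> \<otimes>\<^bsub>RU\<^esub> pure \<one> (unit_fraction (t j)) = pure (t j) (unit_fraction (t j))"
      using pure_mult[OF trace_closed[OF jc] U.one_closed R.one_closed unit_fraction_closed[OF a]]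
        R.r_one[OF trace_closed[OF jc]] U.l_one[OF unit_fraction_closed[OF a]] by simp
    also have "\<dots> = \<one>\<^bsub>RU\<^esub>"
      using pure_trace[OF A'_closed[OF a] unit_fraction_closed[OF a]] embedding_unit_fraction_self[OF a]
      by (simp only: pure_one)
    finally have "\<one>\<^bsub>RU\<^esub> \<in> I" .
    then show ?thesis using I.one_imp_carrier by blast
  next
    case False
    then have null: "t x = \<zero>" if "x \<in> J" for x using that by blast
    \<comment> \<open>Positive powers stay in \<open>J\<close>, so all their traces vanish and
      \<open>nilpotent_of_null_traces\<close> applies.\<close>
    have pow: "x [^] j \<in> J" if x: "x \<in> J" and j: "0 < j" for x and j :: nat
    proof -
      obtain i where "j = Suc i" using j gr0_implies_Suc by blast
      then show ?thesis
        using J.I_l_closed[OF x R.nat_pow_closed[OF JC(1)[OF x]]] by simp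
    qed
    have "J = {\<zero>}"
      by (rule R.nil_trace_null_ideal_zero[OF prime tf J null nilpotent_of_null_traces])
        (use null pow JC in blast)+
    then have r0: "r = \<zero>" if "r \<in> carrier R" "pure r \<one>\<^bsub>G\<^esub> \<in> I" for r
      using J_I[OF that] by blast
    \<comment> \<open>A zero contraction forces \<open>I\<close> to be zero, since multiplying
      \<open>r \<otimes> 1/d\<close> by \<open>1 \<otimes> d\<close> lands in the image of
      \<open>R\<close>.\<close>
    have "x = \<zero>\<^bsub>RU\<^esub>" if x: "x \<in> I" for x
    proof -
      obtain r d where r: "r \<in> carrier R" "d \<in> A'" "x = pure r (unit_fraction d)"
        using I.Icarr[OF x] by (rule tensor_cases)
      have d: "\<iota> d \<in> carrier G" "unit_fraction d \<in> carrier G"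
        by (intro embedding_closed unit_fraction_closed A'_closed r(2))+
      have "x \<otimes>\<^bsub>RU\<^esub> pure \<one> (\<iota> d) = pure r \<one>\<^bsub>G\<^esub>"
        using pure_mult[OF r(1) d(2) R.one_closed d(1)] U.m_comm[OF d] 
          embedding_unit_fraction_self[OF r(2)] R.r_one[OF r(1)] r(3) by simp
      moreover have "x \<otimes>\<^bsub>RU\<^esub> pure \<one> (\<iota> d) \<in> I"
        by (intro I.I_r_closed x pure_closed R.one_closed d)
      ultimately have "r = \<zero>" using r0[OF r(1)] by simp
      then show ?thesis using r pure_eq_zero_iff by blast
    qed
    then show ?thesis using I.zero_closed by blast
  qed
qed

end

section \<open>Homogeneity of the Cayley--Hamilton polynomial\<close>

lemma trace_ring_components:
  "carrier (trace_ring Q s) = s ` carrier Q" "monoid.mult (trace_ring Q s) = monoid.mult Q"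
  "one (trace_ring Q s) = one Q" "ring.add (trace_ring Q s) = ring.add Q"
  by (simp_all add: trace_ring_def)

locale prime_CH_algebra = prime_trace_ring R t n
  for R :: "('k, 'a, 'm) module_scheme" (structure) and t :: "'a \<Rightarrow> 'a" and n :: nat +
  fixes K :: "('k, 'l) ring_scheme"
  assumes CH: "CH_algebra n K R t"
begin

lemmas trace_alg = CH_algebra.axioms(1)[OF CH]
lemmas assoc_alg = trace_algebra.axioms(1)[OF trace_alg]
lemmas field_K = assoc_algebra.axioms(1)[OF assoc_alg]
lemmas module_K = assoc_algebra.axioms(2)[OF assoc_alg]
lemmas smult_closed = module.smult_closed[OF module_K]

definition inv_nat where "inv_nat m = inv\<^bsub>K\<^esub> (of_nat_field K m)"

lemma inv_nat_closed: "0 < m \<Longrightarrow> inv_nat m \<in> carrier K"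
proof -
  interpret K: field K by (rule field_K)
  assume "0 < m"
  then have "of_nat_field K m \<noteq> \<zero>\<^bsub>K\<^esub>"
    by (rule char_zero_field.char_zero[OF CH_algebra.axioms(2)[OF CH]])
  moreover have "of_nat_field K m \<in> carrier K" by (simp add: of_nat_field_def)
  ultimately show ?thesis unfolding inv_nat_def using K.field_Units by (intro K.Units_inv_closed) simp
qed

section \<open>Ground field action and trace axioms on the extension\<close>

lemma smult_pure:
  assumes "c \<in> carrier K" "r \<in> carrier R" "u \<in> carrier G"
  shows "c \<odot>\<^bsub>RU\<^esub> pure r u = pure (c \<odot>\<^bsub>R\<^esub> r) u"
  unfolding tensor_algebra_simps
proof (rule tensor_lift_pure)
  fix r s assume "r \<in> carrier R" "s \<in> carrier R"
  then show "c \<odot>\<^bsub>R\<^esub> (r \<oplus> s) = c \<odot>\<^bsub>R\<^esub> r \<oplus> c \<odot>\<^bsub>R\<^esub> s"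
    by (intro module.smult_r_distr[OF module_K] assms(1))
next
  fix r a assume "r \<in> carrier R" "a \<in> carrier A"
  then show "c \<odot>\<^bsub>R\<^esub> (r \<otimes> a) = c \<odot>\<^bsub>R\<^esub> r \<otimes> a"
    using assoc_algebra.smult_mult_left[OF assoc_alg assms(1)] A_closed by simp
qed (use assms smult_closed in auto)

lemma assoc_algebra_tensor: "assoc_algebra K RU"
proof -
  interpret T: ring RU by (rule ring_tensor_algebra)
  interpret M: Module.module K R by (rule module_K)
  have closed: "c \<odot>\<^bsub>RU\<^esub> x \<in> carrier RU" if c: "c \<in> carrier K" and x: "x \<in> carrier RU" for c x
  proof -
    obtain r d where r: "r \<in> carrier R" "d \<in> A'" "x = pure r (unit_fraction d)"
      using x by (rule tensor_cases)
    show ?thesis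
      unfolding r(3) smult_pure[OF c r(1) unit_fraction_closed[OF r(2)]]
      by (intro pure_closed smult_closed c r unit_fraction_closed)
  qed
  show ?thesis
  proof (intro assoc_algebra.intro assoc_algebra_axioms.intro Module.module.intro Module.module_axioms.intro)
    show "field K" by (rule field_K)
    show "cring K" by (rule Module.module.axioms(1)[OF module_K])
    show "ring RU" by (rule ring_tensor_algebra)
    show "abelian_group RU" by (rule T.abelian_group_axioms)
    show "c \<odot>\<^bsub>RU\<^esub> x \<in> carrier RU" if "c \<in> carrier K" "x \<in> carrier RU" for c x
      using that by (rule closed)
  next
    fix c e x assume c: "c \<in> carrier K" and e: "e \<in> carrier K" and x: "x \<in> carrier RU"
    obtain r d where r: "r \<in> carrier R" "d \<in> A'" "x = pure r (unit_fraction d)"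
      using x by (rule tensor_cases)
    have u: "unit_fraction d \<in> carrier G" using r(2) by (rule unit_fraction_closed)
    have cr: "c \<odot>\<^bsub>R\<^esub> r \<in> carrier R" "e \<odot>\<^bsub>R\<^esub> r \<in> carrier R"
      using smult_closed c e r(1) by blast+
    have ce: "c \<oplus>\<^bsub>K\<^esub> e \<in> carrier K" "c \<otimes>\<^bsub>K\<^esub> e \<in> carrier K" using c e by simp_all
    show "(c \<oplus>\<^bsub>K\<^esub> e) \<odot>\<^bsub>RU\<^esub> x = c \<odot>\<^bsub>RU\<^esub> x \<oplus>\<^bsub>RU\<^esub> e \<odot>\<^bsub>RU\<^esub> x"
      unfolding r(3) smult_pure[OF c r(1) u] smult_pure[OF e r(1) u] smult_pure[OF ce(1) r(1) u]
        pure_add_left[OF cr u] M.smult_l_distr[OF c e r(1)] ..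
    show "(c \<otimes>\<^bsub>K\<^esub> e) \<odot>\<^bsub>RU\<^esub> x = c \<odot>\<^bsub>RU\<^esub> (e \<odot>\<^bsub>RU\<^esub> x)"
      unfolding r(3) smult_pure[OF e r(1) u] smult_pure[OF c cr(2) u] smult_pure[OF ce(2) r(1) u]
        M.smult_assoc1[OF c e r(1)] ..
  next
    fix x assume x: "x \<in> carrier RU"
    obtain r d where r: "r \<in> carrier R" "d \<in> A'" "x = pure r (unit_fraction d)"
      using x by (rule tensor_cases)
    show "\<one>\<^bsub>K\<^esub> \<odot>\<^bsub>RU\<^esub> x = x"
      unfolding r(3) smult_pure[OF M.one_closed r(1) unit_fraction_closed[OF r(2)]]
        M.smult_one[OF r(1)] ..
  next
    fix c x y assume c: "c \<in> carrier K" and x: "x \<in> carrier RU" and y: "y \<in> carrier RU"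
    obtain r s d where r: "r \<in> carrier R" "s \<in> carrier R" "d \<in> A'"
      "x = pure r (unit_fraction d)" "y = pure s (unit_fraction d)"
      using x y by (rule tensor_cases2)
    have u: "unit_fraction d \<in> carrier G" using r(3) by (rule unit_fraction_closed)
    have cr: "c \<odot>\<^bsub>R\<^esub> r \<in> carrier R" "c \<odot>\<^bsub>R\<^esub> s \<in> carrier R"
      using smult_closed c r(1,2) by blast+
    have rs: "r \<oplus> s \<in> carrier R" "r \<otimes> s \<in> carrier R" using r(1,2) by simp_all
    have uu: "unit_fraction d \<otimes>\<^bsub>G\<^esub> unit_fraction d \<in> carrier G" using u u by (rule U.m_closed)
    show "c \<odot>\<^bsub>RU\<^esub> (x \<oplus>\<^bsub>RU\<^esub> y) = c \<odot>\<^bsub>RU\<^esub> x \<oplus>\<^bsub>RU\<^esub> c \<odot>\<^bsub>RU\<^esub> y"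
      unfolding r(4,5) pure_add_left[OF r(1,2) u] smult_pure[OF c r(1) u] smult_pure[OF c r(2) u]
        smult_pure[OF c rs(1) u] pure_add_left[OF cr u] M.smult_r_distr[OF c r(1,2)] ..
    show "(c \<odot>\<^bsub>RU\<^esub> x) \<otimes>\<^bsub>RU\<^esub> y = c \<odot>\<^bsub>RU\<^esub> (x \<otimes>\<^bsub>RU\<^esub> y)"
      unfolding r(4,5) smult_pure[OF c r(1) u] pure_mult[OF cr(1) u r(2) u] pure_mult[OF r(1) u r(2) u]
        smult_pure[OF c rs(2) uu] assoc_algebra.smult_mult_left[OF assoc_alg c r(1,2)] ..
    show "x \<otimes>\<^bsub>RU\<^esub> (c \<odot>\<^bsub>RU\<^esub> y) = c \<odot>\<^bsub>RU\<^esub> (x \<otimes>\<^bsub>RU\<^esub> y)"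
      unfolding r(4,5) smult_pure[OF c r(2) u] pure_mult[OF r(1) u cr(2) u] pure_mult[OF r(1) u r(2) u]
        smult_pure[OF c rs(2) uu] assoc_algebra.smult_mult_right[OF assoc_alg c r(1,2)] ..
  qed
qed

lemma trace_algebra_tensor: "trace_algebra K RU tG"
proof (intro trace_algebra.intro trace_algebra_axioms.intro)
  show "assoc_algebra K RU" by (rule assoc_algebra_tensor)
next
  fix x assume x: "x \<in> carrier RU"
  obtain r d where r: "r \<in> carrier R" "d \<in> A'" "x = pure r (unit_fraction d)"
    using x by (rule tensor_cases)
  have u: "unit_fraction d \<in> carrier G" using r(2) by (rule unit_fraction_closed)
  show "tG x \<in> carrier RU"
    unfolding r(3) tensor_trace_pure[OF r(1) u] by (intro pure_closed trace_closed r(1) u)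
  fix c assume c: "c \<in> carrier K"
  show "tG (c \<odot>\<^bsub>RU\<^esub> x) = c \<odot>\<^bsub>RU\<^esub> tG x"
    unfolding r(3) tensor_trace_pure[OF r(1) u] smult_pure[OF c r(1) u]
      smult_pure[OF c trace_closed[OF r(1)] u] tensor_trace_pure[OF smult_closed[OF c r(1)] u]
      trace_algebra.trace_smult[OF trace_alg c r(1)] ..
next
  fix x y assume x: "x \<in> carrier RU" and y: "y \<in> carrier RU"
  obtain r s d where r: "r \<in> carrier R" "s \<in> carrier R" "d \<in> A'"
    "x = pure r (unit_fraction d)" "y = pure s (unit_fraction d)"
    using x y by (rule tensor_cases2)
  have u: "unit_fraction d \<in> carrier G" using r(3) by (rule unit_fraction_closed)
  have uu: "unit_fraction d \<otimes>\<^bsub>G\<^esub> unit_fraction d \<in> carrier G" using u u by (rule U.m_closed)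
  have tr: "t r \<in> carrier R" "t s \<in> carrier R" using r(1,2) by simp_all
  note simps = r(4,5) tensor_trace_pure[OF r(1) u] tensor_trace_pure[OF r(2) u]
  show "tG (x \<oplus>\<^bsub>RU\<^esub> y) = tG x \<oplus>\<^bsub>RU\<^esub> tG y"
    unfolding simps pure_add_left[OF r(1,2) u] tensor_trace_pure[OF R.add.m_closed[OF r(1,2)] u]
      pure_add_left[OF tr u] trace_add[OF r(1,2)] ..
  show "tG x \<otimes>\<^bsub>RU\<^esub> y = y \<otimes>\<^bsub>RU\<^esub> tG x"
    unfolding simps pure_mult[OF tr(1) u r(2) u] pure_mult[OF r(2) u tr(1) u] trace_central[OF r(1,2)] ..
  show "tG (x \<otimes>\<^bsub>RU\<^esub> y) = tG (y \<otimes>\<^bsub>RU\<^esub> x)"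
    unfolding simps pure_mult[OF r(1) u r(2) u] pure_mult[OF r(2) u r(1) u]
      tensor_trace_pure[OF R.m_closed[OF r(1,2)] uu] tensor_trace_pure[OF R.m_closed[OF r(2,1)] uu]
      trace_commute[OF r(1,2)] ..
  show "tG (tG x \<otimes>\<^bsub>RU\<^esub> y) = tG x \<otimes>\<^bsub>RU\<^esub> tG y"
    unfolding simps pure_mult[OF tr(1) u r(2) u] pure_mult[OF tr(1) u tr(2) u]
      tensor_trace_pure[OF R.m_closed[OF tr(1) r(2)] uu] trace_trace_mult[OF r(1,2)] ..
qed

lemma pure_finsum:
  assumes "finite S" "\<And>i. i \<in> S \<Longrightarrow> f i \<in> carrier R" "u \<in> carrier G"
  shows "pure (\<Oplus>i\<in>S. f i) u = (\<Oplus>\<^bsub>RU\<^esub>i\<in>S. pure (f i) u)"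
proof -
  interpret T: ring RU by (rule ring_tensor_algebra)
  show ?thesis
    using assms(1,2)
  proof (induction S rule: finite_induct)
    case empty
    then show ?case using pure_zero_left[OF assms(3)] by simp
  next
    case (insert i S)
    have f: "f \<in> S \<rightarrow> carrier R" "f i \<in> carrier R" using insert(4) by auto
    then have p: "(\<lambda>i. pure (f i) u) \<in> S \<rightarrow> carrier RU" "pure (f i) u \<in> carrier RU"
      using assms(3) by (simp_all add: Pi_iff)
    have "pure (\<Oplus>i\<in>insert i S. f i) u = pure (f i) u \<oplus>\<^bsub>RU\<^esub> pure (\<Oplus>i\<in>S. f i) u"
      using R.finsum_insert[OF insert(1,2) f] pure_add_left[OF f(2) R.finsum_closed[OF f(1)] assms(3)]
      by simp
    then show ?case
      using T.finsum_insert[OF insert(1,2) p] insert by simp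
  qed
qed

lemma pure_pow:
  assumes "r \<in> carrier R" "u \<in> carrier G"
  shows "pure r u [^]\<^bsub>RU\<^esub> (i :: nat) = pure (r [^] i) (u [^]\<^bsub>G\<^esub> i)"
proof -
  interpret T: ring RU by (rule ring_tensor_algebra)
  show ?thesis
    by (induction i)
      (simp_all add: pure_one pure_mult R.nat_pow_closed U.nat_pow_closed assms)
qed

section \<open>Power series after rescaling: degree \<open>i\<close> acquires the factor
  \<open>u^i\<close>\<close>

lemma ps_mult_closed:
  "\<lbrakk>\<And>i. f i \<in> carrier R; \<And>i. g i \<in> carrier R\<rbrakk> \<Longrightarrow> ps_mult R f g i \<in> carrier R"
  unfolding ps_mult_def by (rule R.finsum_closed) simp

lemma ps_pow_closed: "(\<And>i. f i \<in> carrier R) \<Longrightarrow> ps_pow R f m i \<in> carrier R"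
  by (induction m arbitrary: i) (simp_all add: ps_mult_closed)

lemma ps_exp_closed: "(\<And>i. f i \<in> carrier R) \<Longrightarrow> ps_exp K R f i \<in> carrier R"
  unfolding ps_exp_def inv_nat_def[symmetric]
  using ps_pow_closed[of f] inv_nat_closed[OF fact_gt_zero] smult_closed
  by (intro R.finsum_closed) (simp add: Pi_def)

lemma trace_log_series_closed:
  assumes "r \<in> carrier R" shows "trace_log_series K R t r j \<in> carrier R"
  unfolding trace_log_series_def inv_nat_def[symmetric]
  using smult_closed[OF inv_nat_closed[of j], of "t (r [^] j)"] assms by simp

lemma sigma_closed: "r \<in> carrier R \<Longrightarrow> sigma K R t i r \<in> carrier R"
  unfolding sigma_def using ps_exp_closed trace_log_series_closed by simp

context
  fixes u assumes u: "u \<in> carrier G"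
begin

lemma u_pow: "u [^]\<^bsub>G\<^esub> (i :: nat) \<in> carrier G"
  using u by (rule U.nat_pow_closed)

text \<open>The factors of degrees \<open>k\<close> and \<open>i - k\<close> contribute
  \<open>u^k u^(i-k) = u^i\<close>, independent of \<open>k\<close>. The convolution sum thus has a
  common second factor and stays a pure tensor.\<close>

lemma ps_mult_pure:
  assumes "\<And>i. f i \<in> carrier R" "\<And>i. g i \<in> carrier R"
  shows "ps_mult RU (\<lambda>i. pure (f i) (u [^]\<^bsub>G\<^esub> i)) (\<lambda>i. pure (g i) (u [^]\<^bsub>G\<^esub> i)) i
    = pure (ps_mult R f g i) (u [^]\<^bsub>G\<^esub> i)"
proof -
  interpret T: ring RU by (rule ring_tensor_algebra)
  have "pure (f k) (u [^]\<^bsub>G\<^esub> k) \<otimes>\<^bsub>RU\<^esub> pure (g (i - k)) (u [^]\<^bsub>G\<^esub> (i - k))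
    = pure (f k \<otimes> g (i - k)) (u [^]\<^bsub>G\<^esub> i)" if "k \<in> {..i}" for k
    using pure_mult[OF assms(1) u_pow assms(2) u_pow, of k k "i - k" "i - k"] U.nat_pow_mult[OF u, of k "i - k"] that
    by simp
  then have "ps_mult RU (\<lambda>i. pure (f i) (u [^]\<^bsub>G\<^esub> i)) (\<lambda>i. pure (g i) (u [^]\<^bsub>G\<^esub> i)) i
    = (\<Oplus>\<^bsub>RU\<^esub>k\<in>{..i}. pure (f k \<otimes> g (i - k)) (u [^]\<^bsub>G\<^esub> i))"
    unfolding ps_mult_def using assms u_pow by (intro T.finsum_cong' refl) simp_all
  also have "\<dots> = pure (ps_mult R f g i) (u [^]\<^bsub>G\<^esub> i)"
    unfolding ps_mult_def using assms u_pow by (intro pure_finsum[symmetric]) simp_all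
  finally show ?thesis .
qed

lemma ps_pow_pure:
  assumes "\<And>i. f i \<in> carrier R"
  shows "ps_pow RU (\<lambda>i. pure (f i) (u [^]\<^bsub>G\<^esub> i)) m = (\<lambda>i. pure (ps_pow R f m i) (u [^]\<^bsub>G\<^esub> i))"
proof (induction m)
  case 0
  show ?case using pure_zero_left[OF u_pow] by (intro ext) (simp add: pure_one)
next
  case (Suc m)
  show ?case
    unfolding ps_pow.simps Suc using ps_pow_closed assms by (intro ext ps_mult_pure) simp_all
qed

lemma ps_exp_pure:
  assumes "\<And>i. f i \<in> carrier R"
  shows "ps_exp K RU (\<lambda>i. pure (f i) (u [^]\<^bsub>G\<^esub> i)) i = pure (ps_exp K R f i) (u [^]\<^bsub>G\<^esub> i)"
proof -
  interpret T: ring RU by (rule ring_tensor_algebra)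
  have c: "inv_nat (fact m) \<in> carrier K" for m
    by (rule inv_nat_closed[OF fact_gt_zero])
  have cl: "inv_nat (fact m) \<odot>\<^bsub>R\<^esub> ps_pow R f m i \<in> carrier R" for m i
    using smult_closed[OF c ps_pow_closed[of f]] assms by blast
  have "ps_exp K RU (\<lambda>i. pure (f i) (u [^]\<^bsub>G\<^esub> i)) i
    = (\<Oplus>\<^bsub>RU\<^esub>m\<in>{..i}. pure (inv_nat (fact m) \<odot>\<^bsub>R\<^esub> ps_pow R f m i) (u [^]\<^bsub>G\<^esub> i))"
    unfolding ps_exp_def inv_nat_def[symmetric] ps_pow_pure[OF assms]
      smult_pure[OF c ps_pow_closed[OF assms] u_pow] ..
  also have "\<dots> = pure (ps_exp K R f i) (u [^]\<^bsub>G\<^esub> i)"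
    unfolding ps_exp_def inv_nat_def[symmetric]
    using cl u_pow by (intro pure_finsum[symmetric]) simp_all
  finally show ?thesis .
qed

text \<open>Multiplicativity of pure tensors gives
  \<open>t((r \<otimes> u)^j) = t(r^j) \<otimes> u^j\<close>; in degree 0 both sides are
  zero.\<close>

lemma trace_log_series_pure:
  assumes r: "r \<in> carrier R"
  shows "trace_log_series K RU tG (pure r u)
    = (\<lambda>j. pure (trace_log_series K R t r j) (u [^]\<^bsub>G\<^esub> j))"
proof
  fix j :: nat
  have rj: "r [^] j \<in> carrier R" using r by simp
  show "trace_log_series K RU tG (pure r u) j = pure (trace_log_series K R t r j) (u [^]\<^bsub>G\<^esub> j)"
  proof (cases "j = 0")
    case True
    then show ?thesis using pure_zero_left[OF U.one_closed] by (simp add: trace_log_series_def)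
  next
    case False
    then have c: "inv_nat j \<in> carrier K" by (intro inv_nat_closed) simp
    show ?thesis
      using False
      by (simp add: trace_log_series_def flip: inv_nat_def)
        (simp only: pure_pow[OF r u] tensor_trace_pure[OF rj u_pow] smult_pure[OF c trace_closed[OF rj] u_pow]
          pure_minus[OF smult_closed[OF c trace_closed[OF rj]] u_pow])
  qed
qed

lemma sign_pure: "(\<ominus>\<^bsub>RU\<^esub> \<one>\<^bsub>RU\<^esub>) [^]\<^bsub>RU\<^esub> (i :: nat) = pure ((\<ominus> \<one>) [^] i) \<one>\<^bsub>G\<^esub>"
  unfolding pure_one pure_minus[OF R.one_closed U.one_closed]
    pure_pow[OF R.a_inv_closed[OF R.one_closed] U.one_closed] U.nat_pow_one ..

lemma sign_closed: "(\<ominus> \<one>) [^] (i :: nat) \<in> carrier R"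
  by simp

lemma sigma_pure:
  assumes r: "r \<in> carrier R"
  shows "sigma K RU tG i (pure r u) = pure (sigma K R t i r) (u [^]\<^bsub>G\<^esub> i)"
proof -
  have e: "ps_exp K R (trace_log_series K R t r) i \<in> carrier R"
    using ps_exp_closed trace_log_series_closed[OF r] by blast
  show ?thesis
    unfolding sigma_def sign_pure trace_log_series_pure[OF r]
      ps_exp_pure[OF trace_log_series_closed[OF r]] pure_mult[OF sign_closed U.one_closed e u_pow]
      U.l_one[OF u_pow] ..
qed

text \<open>Each summand has weight \<open>i\<close> from \<open>sigma\<close> and
  \<open>n - i\<close> from the power, hence total weight \<open>n\<close>, so the common factor
  \<open>u^n\<close> comes out of the sum.\<close>

lemma CH_poly_pure:
  assumes r: "r \<in> carrier R"
  shows "CH_poly n K RU tG (pure r u) = pure (CH_poly n K R t r) (u [^]\<^bsub>G\<^esub> n)"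
proof -
  interpret T: ring RU by (rule ring_tensor_algebra)
  let ?f = "\<lambda>i. (\<ominus> \<one>) [^] i \<otimes> sigma K R t i r \<otimes> r [^] (n - i)"
  have f: "?f i \<in> carrier R" for i using sigma_closed[OF r] r by simp
  have summand: "(\<ominus>\<^bsub>RU\<^esub> \<one>\<^bsub>RU\<^esub>) [^]\<^bsub>RU\<^esub> i \<otimes>\<^bsub>RU\<^esub> sigma K RU tG i (pure r u) \<otimes>\<^bsub>RU\<^esub> pure r u [^]\<^bsub>RU\<^esub> (n - i)
      = pure (?f i) (u [^]\<^bsub>G\<^esub> n)" if i: "i \<in> {1..n}" for i
  proof -
    have "u [^]\<^bsub>G\<^esub> i \<otimes>\<^bsub>G\<^esub> u [^]\<^bsub>G\<^esub> (n - i) = u [^]\<^bsub>G\<^esub> n"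
      using U.nat_pow_mult[OF u, of i "n - i"] i by simp
    then show ?thesis
      unfolding sign_pure sigma_pure[OF r] pure_pow[OF r u]
        pure_mult[OF sign_closed U.one_closed sigma_closed[OF r] u_pow] U.l_one[OF u_pow]
        pure_mult[OF R.m_closed[OF sign_closed sigma_closed[OF r]] u_pow R.nat_pow_closed[OF r] u_pow]
      by simp
  qed
  have "(\<Oplus>\<^bsub>RU\<^esub>i\<in>{1..n}. (\<ominus>\<^bsub>RU\<^esub> \<one>\<^bsub>RU\<^esub>) [^]\<^bsub>RU\<^esub> i \<otimes>\<^bsub>RU\<^esub> sigma K RU tG i (pure r u) \<otimes>\<^bsub>RU\<^esub> pure r u [^]\<^bsub>RU\<^esub> (n - i))
      = (\<Oplus>\<^bsub>RU\<^esub>i\<in>{1..n}. pure (?f i) (u [^]\<^bsub>G\<^esub> n))"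
    by (rule T.finsum_cong'[OF refl _ summand]) (intro funcsetI pure_closed f u_pow, assumption)
  also have "\<dots> = pure (\<Oplus>i\<in>{1..n}. ?f i) (u [^]\<^bsub>G\<^esub> n)"
    by (rule pure_finsum[symmetric]) (simp_all only: finite_atLeastAtMost f u_pow)
  finally show ?thesis
    unfolding CH_poly_def pure_pow[OF r u]
    using pure_add_left[OF R.nat_pow_closed[OF r] R.finsum_closed u_pow, of ?f "{1..n}" n n] f by simp
qed

end

lemma pure_add_pow:
  assumes "r \<in> carrier R" "u \<in> carrier G"
  shows "[(m :: nat)] \<cdot>\<^bsub>RU\<^esub> pure r u = pure ([m] \<cdot>\<^bsub>R\<^esub> r) u"
proof -
  interpret T: ring RU by (rule ring_tensor_algebra)
  show ?thesis
    using assms by (induction m) (simp_all add: pure_zero_left pure_add_left)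
qed

text \<open>By \<open>tensor_cases\<close> an arbitrary element is one pure tensor, so homogeneity
  settles the nonlinear identity without passing to its polarization.\<close>

lemma CH_algebra_tensor: "CH_algebra n K RU tG"
proof (intro CH_algebra.intro CH_algebra_axioms.intro)
  show "trace_algebra K RU tG" by (rule trace_algebra_tensor)
  show "char_zero_field K" by (rule CH_algebra.axioms(2)[OF CH])
  show "tG \<one>\<^bsub>RU\<^esub> = [n] \<cdot>\<^bsub>RU\<^esub> \<one>\<^bsub>RU\<^esub>"
    unfolding pure_one tensor_trace_pure[OF R.one_closed U.one_closed]
      pure_add_pow[OF R.one_closed U.one_closed] CH_algebra.trace_one[OF CH] ..
  fix x assume x: "x \<in> carrier RU"
  obtain r d where r: "r \<in> carrier R" "d \<in> A'" "x = pure r (unit_fraction d)"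
    using x by (rule tensor_cases)
  show "CH_poly n K RU tG x = \<zero>\<^bsub>RU\<^esub>"
    unfolding r(3) CH_poly_pure[OF unit_fraction_closed[OF r(2)] r(1)] CH_algebra.Cayley_Hamilton[OF CH r(1)]
    by (rule pure_zero_left[OF U.nat_pow_closed[OF unit_fraction_closed[OF r(2)]]])
qed

text \<open>Surjectivity is \<open>tensor_trace_image\<close>. For injectivity, \<open>x - y\<close>
  is cleared to some \<open>a\<close> in \<open>A\<close> with \<open>a \<otimes> 1 = 0\<close>;
  then \<open>a = 0\<close> by \<open>pure_one_inj\<close>, and multiplying back by
  \<open>unit_fraction d\<close> gives \<open>x = y\<close>.\<close>

lemma pure_one_ring_iso: "pure \<one> \<in> ring_iso G (trace_ring RU tG)"
proof (rule ring_iso_memI)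
  have simps: "carrier (trace_ring RU tG) = pure \<one> ` carrier G"
    "monoid.mult (trace_ring RU tG) = monoid.mult RU" "one (trace_ring RU tG) = one RU"
    "ring.add (trace_ring RU tG) = ring.add RU"
    by (simp_all only: trace_ring_components tensor_trace_image)
  fix x assume x: "x \<in> carrier G"
  then show "pure \<one> x \<in> carrier (trace_ring RU tG)" by (simp add: simps)
  fix y assume y: "y \<in> carrier G"
  show "pure \<one> (x \<otimes>\<^bsub>G\<^esub> y) = pure \<one> x \<otimes>\<^bsub>trace_ring RU tG\<^esub> pure \<one> y"
    unfolding simps pure_mult[OF R.one_closed x R.one_closed y] R.l_one[OF R.one_closed] ..
  show "pure \<one> (x \<oplus>\<^bsub>G\<^esub> y) = pure \<one> x \<oplus>\<^bsub>trace_ring RU tG\<^esub> pure \<one> y"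
    unfolding simps pure_add_right[OF R.one_closed x y] ..
next
  show "pure \<one> \<one>\<^bsub>G\<^esub> = \<one>\<^bsub>trace_ring RU tG\<^esub>"
    by (simp only: trace_ring_components pure_one)
  have "x = y" if x: "x \<in> carrier G" and y: "y \<in> carrier G" and eq: "pure \<one> x = pure \<one> y" for x y
  proof -
    obtain a d where a: "a \<in> carrier A" "d \<in> A'" "\<iota> d \<otimes>\<^bsub>G\<^esub> (x \<ominus>\<^bsub>G\<^esub> y) = \<iota> a"
      using U.minus_closed[OF x y] by (rule A.fraction_embedding_clear)
    interpret T: ring RU by (rule ring_tensor_algebra)
    have d: "\<iota> d \<in> carrier G" by (intro embedding_closed A'_closed a(2))
    have xy: "x \<ominus>\<^bsub>G\<^esub> y \<in> carrier G" using x y by (rule U.minus_closed)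
    have "pure \<one> (x \<ominus>\<^bsub>G\<^esub> y) \<oplus>\<^bsub>RU\<^esub> pure \<one> y = pure \<one> ((x \<ominus>\<^bsub>G\<^esub> y) \<oplus>\<^bsub>G\<^esub> y)"
      by (rule pure_add_right[OF R.one_closed xy y])
    also have "(x \<ominus>\<^bsub>G\<^esub> y) \<oplus>\<^bsub>G\<^esub> y = x"
      using x y by (simp add: U.minus_eq U.a_assoc U.l_neg)
    finally have zero: "pure \<one> (x \<ominus>\<^bsub>G\<^esub> y) = \<zero>\<^bsub>RU\<^esub>"
      using eq T.add.l_cancel_one' pure_closed[OF R.one_closed xy] pure_closed[OF R.one_closed y]
      by (metis T.add.r_cancel_one)
    have "pure a \<one>\<^bsub>G\<^esub> = pure \<one> (\<iota> d \<otimes>\<^bsub>G\<^esub> (x \<ominus>\<^bsub>G\<^esub> y))"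
      using pure_trace[OF a(1) U.one_closed] a(3) embedding_closed[OF a(1)] by simp
    also have "\<dots> = pure \<one> (\<iota> d) \<otimes>\<^bsub>RU\<^esub> pure \<one> (x \<ominus>\<^bsub>G\<^esub> y)"
      using pure_mult[OF R.one_closed d R.one_closed xy] by simp
    also have "\<dots> = \<zero>\<^bsub>RU\<^esub>" unfolding zero by (intro T.r_null pure_closed R.one_closed d)
    also have "\<dots> = pure \<zero> \<one>\<^bsub>G\<^esub>" by (rule pure_zero_left[OF U.one_closed, symmetric])
    finally have "a = \<zero>" using pure_one_inj[OF A_closed R.zero_closed] a(1) by simp
    then have "\<iota> d \<otimes>\<^bsub>G\<^esub> (x \<ominus>\<^bsub>G\<^esub> y) = \<zero>\<^bsub>G\<^esub>"
      using a(3) by (simp add: fraction_embedding_def A.fraction_field_zero)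
    then have "unit_fraction d \<otimes>\<^bsub>G\<^esub> \<iota> d \<otimes>\<^bsub>G\<^esub> (x \<ominus>\<^bsub>G\<^esub> y) = \<zero>\<^bsub>G\<^esub>"
      using U.m_assoc[OF unit_fraction_closed[OF a(2)] d xy] U.r_null[OF unit_fraction_closed[OF a(2)]] by simp
    then have "x \<ominus>\<^bsub>G\<^esub> y = \<zero>\<^bsub>G\<^esub>"
      using U.m_comm[OF unit_fraction_closed[OF a(2)] d] embedding_unit_fraction_self[OF a(2)] xy by simp
    then show ?thesis using x y U.r_right_minus_eq by blast
  qed
  then have "inj_on (pure \<one>) (carrier G)" by (rule inj_onI)
  then show "bij_betw (pure \<one>) (carrier G) (carrier (trace_ring RU tG))"
    by (simp only: bij_betw_def trace_ring_components tensor_trace_image simp_thms)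
qed

end

section \<open>Prime Cayley--Hamilton algebras\<close>

lemma (in ring) ps_pow_zero:
  "0 < m \<Longrightarrow> ps_pow R (\<lambda>j. \<zero>) m = (\<lambda>i. \<zero>)"
proof (induction m)
  case (Suc m)
  \<comment> \<open>For \<open>m = 0\<close> the previous power is the unit series, so only
    membership of its coefficients in the carrier is used; the other factor is zero in any
    case.\<close>
  have c: "ps_pow R (\<lambda>j. \<zero>) m i \<in> carrier R" for i
    using Suc.IH by (cases "m = 0") auto
  show ?case using c by (intro ext) (simp add: ps_mult_def)
qed simp

text \<open>Inverses of positive integers in the ground field give torsion-freeness and, together
  with \<open>t(1) = n\<close>, a preimage of the unit under \<open>t\<close>. The defining series
  give nilpotency.\<close>

lemma prime_CH_algebraI:
  fixes K :: "('k, 'l) ring_scheme" and R :: "('k, 'a, 'm) module_scheme"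
  assumes CH: "CH_algebra n K R t" and prime: "trace_prime R t"
  shows "prime_CH_algebra R t n K"
proof -
  note trace_alg = CH_algebra.axioms(1)[OF CH]
  note assoc_alg = trace_algebra.axioms(1)[OF trace_alg]
  interpret K: field K by (rule assoc_algebra.axioms(1)[OF assoc_alg])
  have module_K: "Module.module K R" by (rule assoc_algebra.axioms(2)[OF assoc_alg])
  interpret R: ring R by (rule assoc_algebra.axioms(3)[OF assoc_alg])
  note smult_closed = module.smult_closed[OF module_K]
  have natK: "of_nat_field K m \<in> carrier K" for m by (simp add: of_nat_field_def)
  have unit: "of_nat_field K m \<in> Units K" if "0 < m" for m
    using char_zero_field.char_zero[OF CH_algebra.axioms(2)[OF CH] that] natK K.field_Units by simp
  have zero_smult: "\<zero>\<^bsub>K\<^esub> \<odot>\<^bsub>R\<^esub> x = \<zero>\<^bsub>R\<^esub>" if x: "x \<in> carrier R" for x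
    using module.smult_l_distr[OF module_K K.zero_closed K.zero_closed x]
      smult_closed[OF K.zero_closed x] R.add.l_cancel_one by simp
  have smult_zero: "c \<odot>\<^bsub>R\<^esub> \<zero>\<^bsub>R\<^esub> = \<zero>\<^bsub>R\<^esub>" if c: "c \<in> carrier K" for c
    using module.smult_r_distr[OF module_K c R.zero_closed R.zero_closed]
      smult_closed[OF c R.zero_closed] R.add.l_cancel_one by simp
  have nat_smult: "of_nat_field K m \<odot>\<^bsub>R\<^esub> x = [m] \<cdot>\<^bsub>R\<^esub> x" if x: "x \<in> carrier R" for m x
  proof (induction m)
    case 0
    then show ?case using zero_smult[OF x] by (simp add: of_nat_field_def)
  next
    case (Suc m)
    then show ?case
      using module.smult_l_distr[OF module_K natK[of m] K.one_closed x] module.smult_one[OF module_K x]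
      by (simp add: of_nat_field_def)
  qed
  have cancel: "inv\<^bsub>K\<^esub> (of_nat_field K m) \<odot>\<^bsub>R\<^esub> ([m] \<cdot>\<^bsub>R\<^esub> x) = x" if "0 < m" "x \<in> carrier R" for m x
  proof -
    note c = K.Units_inv_closed[OF unit[OF that(1)]]
    have "inv\<^bsub>K\<^esub> (of_nat_field K m) \<odot>\<^bsub>R\<^esub> ([m] \<cdot>\<^bsub>R\<^esub> x)
        = (inv\<^bsub>K\<^esub> (of_nat_field K m) \<otimes>\<^bsub>K\<^esub> of_nat_field K m) \<odot>\<^bsub>R\<^esub> x"
      unfolding nat_smult[OF that(2), symmetric]
      by (rule module.smult_assoc1[OF module_K c natK that(2), symmetric])
    then show ?thesis
      unfolding K.Units_l_inv[OF unit[OF that(1)]] module.smult_one[OF module_K that(2)] .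
  qed
  have tf: "torsion_free R"
    unfolding torsion_free_def
  proof (intro allI impI, elim conjE)
    fix m :: nat and x assume m: "0 < m" "x \<in> carrier R" "[m] \<cdot>\<^bsub>R\<^esub> x = \<zero>\<^bsub>R\<^esub>"
    show "x = \<zero>\<^bsub>R\<^esub>"
      using cancel[OF m(1,2)] smult_zero[OF K.Units_inv_closed[OF unit[OF m(1)]]] m(3) by simp
  qed
  \<comment> \<open>For \<open>n = 0\<close> the Cayley--Hamilton polynomial is the constant 1, so
    its vanishing would make the ring zero.\<close>
  have n: "0 < n"
  proof (rule ccontr)
    assume "\<not> 0 < n"
    then have "\<one>\<^bsub>R\<^esub> = \<zero>\<^bsub>R\<^esub>"
      using CH_algebra.Cayley_Hamilton[OF CH R.zero_closed] by (simp add: CH_poly_def)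
    then show False using prime R.one_zeroD by (simp add: trace_prime_def)
  qed
  show ?thesis
  proof (intro prime_CH_algebra.intro prime_trace_ring.intro prime_trace_ring_axioms.intro
      prime_CH_algebra_axioms.intro)
    show "\<one>\<^bsub>R\<^esub> \<in> t ` carrier R"
    proof
      \<comment> \<open>The witness is \<open>1/n\<close>, whose trace is
        \<open>(1/n) t(1) = 1\<close>.\<close>
      have c: "inv\<^bsub>K\<^esub> (of_nat_field K n) \<in> carrier K" using K.Units_inv_closed[OF unit[OF n]] .
      show "inv\<^bsub>K\<^esub> (of_nat_field K n) \<odot>\<^bsub>R\<^esub> \<one>\<^bsub>R\<^esub> \<in> carrier R"
        using smult_closed[OF c R.one_closed] .
      show "\<one>\<^bsub>R\<^esub> = t (inv\<^bsub>K\<^esub> (of_nat_field K n) \<odot>\<^bsub>R\<^esub> \<one>\<^bsub>R\<^esub>)"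
        unfolding trace_algebra.trace_smult[OF trace_alg c R.one_closed] CH_algebra.trace_one[OF CH]
          cancel[OF n R.one_closed] ..
    qed
  next
    fix x assume x: "x \<in> carrier R" and null: "\<And>j. 0 < j \<Longrightarrow> t (x [^]\<^bsub>R\<^esub> (j :: nat)) = \<zero>\<^bsub>R\<^esub>"
    have log: "trace_log_series K R t x = (\<lambda>j. \<zero>\<^bsub>R\<^esub>)"
      using null smult_zero[OF K.Units_inv_closed[OF unit]]
      by (intro ext) (simp add: trace_log_series_def)
    \<comment> \<open>The exponential of the zero series is 1: the term \<open>m = 0\<close> lives
      in degree 0 and all higher terms vanish. Hence \<open>sigma\<close> is zero for every positive
      index.\<close>
    have exp: "ps_exp K R (\<lambda>j. \<zero>\<^bsub>R\<^esub>) i = \<zero>\<^bsub>R\<^esub>" if i: "0 < i" for i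
    proof -
      have "ps_pow R (\<lambda>j. \<zero>\<^bsub>R\<^esub>) m i = \<zero>\<^bsub>R\<^esub>" for m
        using i R.ps_pow_zero[of m] by (cases "m = 0") simp_all
      then show ?thesis
        by (simp add: ps_exp_def smult_zero[OF K.Units_inv_closed[OF unit[OF fact_gt_zero]]])
    qed
    have "(\<Oplus>\<^bsub>R\<^esub>i\<in>{1..n}. (\<ominus>\<^bsub>R\<^esub> \<one>\<^bsub>R\<^esub>) [^]\<^bsub>R\<^esub> i \<otimes>\<^bsub>R\<^esub> sigma K R t i x \<otimes>\<^bsub>R\<^esub> x [^]\<^bsub>R\<^esub> (n - i)) = (\<Oplus>\<^bsub>R\<^esub>i\<in>{1..n}. \<zero>\<^bsub>R\<^esub>)"
      by (rule R.finsum_cong') (use x in \<open>simp_all add: sigma_def log exp\<close>)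
    then show "x [^]\<^bsub>R\<^esub> n = \<zero>\<^bsub>R\<^esub>"
      using CH_algebra.Cayley_Hamilton[OF CH x] x by (simp add: CH_poly_def)
  qed (rule CH prime tf R.ring_axioms trace_algebra.trace_closed[OF trace_alg]
      trace_algebra.trace_add[OF trace_alg] trace_algebra.trace_central[OF trace_alg]
      trace_algebra.trace_commute[OF trace_alg] trace_algebra.trace_trace_mult[OF trace_alg];
      assumption)+
qed

text \<open>Elements of the trace algebra of the extension are cosets, so it is identified with
  \<open>G\<close> through the natural isomorphism \<open>g \<mapsto> 1 \<otimes> g\<close>.\<close>

theorem theorem11p1p2:
  fixes n :: nat
    and K :: "('k, 'l) ring_scheme"
    and R :: "('k, 'a, 'm) module_scheme"
    and t :: "'a \<Rightarrow> 'a"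
  assumes "CH_algebra n K R t"
    and "trace_prime R t"
  defines "A \<equiv> trace_ring R t"
  defines "G \<equiv> fraction_field A"
  defines "\<iota> \<equiv> fraction_embedding A"
  defines "RG \<equiv> tensor_algebra A R G \<iota>"
  defines "tG \<equiv> tensor_trace A R G \<iota> t"
  shows "CH_algebra n K RG tG \<and>
    trace_simple RG tG \<and>
    (\<lambda>g. pure_tensor A R G \<iota> \<one>\<^bsub>R\<^esub> g) \<in> ring_iso G (trace_ring RG tG) \<and>
    inj_on (\<lambda>r. pure_tensor A R G \<iota> r \<one>\<^bsub>G\<^esub>) (carrier R)"
proof -
  interpret L: prime_CH_algebra R t n K using assms(1,2) by (rule prime_CH_algebraI)
  show ?thesis
    unfolding RG_def tG_def \<iota>_def G_def A_def
    using L.CH_algebra_tensor L.trace_simple_tensor L.pure_one_ring_iso L.pure_one_inj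
    by (intro conjI inj_onI)
qed

end
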